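(* Let $p,q\in L_1(0,\pi)$ be complex-valued functions and let $$A=\begin{pmatrix} a_{11}&a_{12}&a_{13}&a_{14}\\ a_{21}&a_{22}&a_{23}&a_{24}\end{pmatrix}$$ be a complex matrix with linearly independent rows. For $1\le j,k\le 4$ let $J_{jk}$ denote the determinant of the $2\times 2$ matrix whose first column is the $j$th column of $A$ and whose second column is the $k$th column of $A$. Suppose that $$J_{14}=J_{23}=J_{13}+J_{24}=0$$ and that $$p(\pi-x)=-p(x),\qquad q(\pi-x)=q(x)\qquad (0\le x\le \pi),$$ where these equalities are understood for almost every $x$. Then the spectrum of the problem $$B\mathbf{y}'+V\mathbf{y}=\lambda\mathbf{y},\qquad U_1(\mathbf{y})=U_2(\mathbf{y})=0,$$ where $$B=\begin{pmatrix}0&1\\-1&0\end{pmatrix},\qquad V(x)=\begin{pmatrix}p(x)&q(x)\\ q(x)&-p(x)\end{pmatrix},$$ $$U_j(\mathbf{y})=a_{j1}y_1(0)+a_{j2}y_2(0)+a_{j3}y_1(\pi)+a_{j4}y_2(\pi)\quad (j=1,2),$$ coincides with the spectrum of the corresponding unperturbed problem $$B\mathbf{y}'=\lambda\mathbf{y},\qquad U_1(\mathbf{y})=U_2(\mathbf{y})=0.$$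
   Context: Here $\mathbf{y}=(y_1,y_2)^{T}$ is a $\mathbb{C}^2$-valued function on $[0,\pi]$ and $\lambda\in\mathbb{C}$ is the spectral parameter. The spectrum of the problem $B\mathbf{y}'+V\mathbf{y}=\lambda\mathbf{y}$, $U_1(\mathbf{y})=U_2(\mathbf{y})=0$, is the spectrum of the linear operator $\mathbb{L}\mathbf{y}=B\mathbf{y}'+V\mathbf{y}$ in the space $\mathbb{H}=L_2(0,\pi)\oplus L_2(0,\pi)$ with domain $$D(\mathbb{L})=\{\mathbf{y}\in W_1^1[0,\pi]:\ \mathbb{L}\mathbf{y}\in\mathbb{H},\ U_1(\mathbf{y})=U_2(\mathbf{y})=0\},$$ where $\mathbf{y}\in W_1^1[0,\pi]$ means that both components of $\mathbf{y}$ are absolutely continuous on $[0,\pi]$. A number $\lambda\in\mathbb{C}$ is an eigenvalue if there is a nonzero $\mathbf{y}\in D(\mathbb{L})$ with $\mathbb{L}\mathbf{y}=\lambda\mathbf{y}$. The spectrum of the unperturbed problem is defined in the same way with $V=0$ (that is, $p=q=0$) and the same boundary forms $U_1,U_2$. *)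

theory Defs
  imports "HOL-Analysis.Analysis"
begin

abbreviation Leb :: "real measure"
  where "Leb \<equiv> lebesgue_on {0..pi}"

definition L1 :: "(real \<Rightarrow> complex) set"
  where "L1 = {f. integrable Leb f}"

definition L2 :: "(real \<Rightarrow> complex) set"
  where "L2 = {f \<in> borel_measurable Leb. integrable Leb (\<lambda>x. (norm (f x))\<^sup>2)}"

text \<open>The elements of the Hilbert space \<open>L\<^sub>2(0,\<pi>) \<oplus> L\<^sub>2(0,\<pi>)\<close> are represented by functions;
  equality of elements is equality almost everywhere on \<open>[0,\<pi>]\<close>.\<close>

definition H :: "(real \<Rightarrow> complex^2) set"
  where "H = {f. \<forall>i. (\<lambda>x. f x $ i) \<in> L2}"

definition norm_H :: "(real \<Rightarrow> complex^2) \<Rightarrow> real"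
  where "norm_H f = sqrt (\<Sum>i\<in>UNIV. LINT x|Leb. (norm (f x $ i))\<^sup>2)"

definition abs_continuous_on :: "real \<Rightarrow> real \<Rightarrow> (real \<Rightarrow> complex) \<Rightarrow> bool"
  where "abs_continuous_on a b f \<longleftrightarrow>
    (\<forall>\<epsilon>>0. \<exists>\<delta>>0. \<forall>(n::nat) (s::nat \<Rightarrow> real) (t::nat \<Rightarrow> real).
       (\<forall>i<n. a \<le> s i \<and> s i \<le> t i \<and> t i \<le> b) \<and>
       (\<forall>i<n. \<forall>j<n. i \<noteq> j \<longrightarrow> {s i<..<t i} \<inter> {s j<..<t j} = {}) \<and>
       (\<Sum>i<n. t i - s i) < \<delta>
       \<longrightarrow> (\<Sum>i<n. norm (f (t i) - f (s i))) < \<epsilon>)"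

definition W11 :: "(real \<Rightarrow> complex^2) set"
  where "W11 = {y. \<forall>i. abs_continuous_on 0 pi (\<lambda>x. y x $ i)}"

definition B :: "complex^2^2"
  where "B = vector [vector [0, 1], vector [-1, 0]]"

definition V :: "(real \<Rightarrow> complex) \<Rightarrow> (real \<Rightarrow> complex) \<Rightarrow> real \<Rightarrow> complex^2^2"
  where "V p q x = vector [vector [p x, q x], vector [q x, - p x]]"

text \<open>For \<open>y \<in> W11\<close> the derivative exists at almost every \<open>x \<in> [0,\<pi>]\<close>; the values of
  \<open>vector_derivative\<close> on the exceptional null set are irrelevant.\<close>

definition Lop :: "(real \<Rightarrow> complex) \<Rightarrow> (real \<Rightarrow> complex) \<Rightarrow> (real \<Rightarrow> complex^2) \<Rightarrow> real \<Rightarrow> complex^2"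
  where "Lop p q y x = B *v vector_derivative y (at x within {0..pi}) + V p q x *v y x"

definition J :: "complex^4^2 \<Rightarrow> 4 \<Rightarrow> 4 \<Rightarrow> complex"
  where "J A j k = det ((\<chi> i m. if m = 1 then A $ i $ j else A $ i $ k) :: complex^2^2)"

definition U :: "complex^4^2 \<Rightarrow> 2 \<Rightarrow> (real \<Rightarrow> complex^2) \<Rightarrow> complex"
  where "U A j y = A $ j $ 1 * y 0 $ 1 + A $ j $ 2 * y 0 $ 2
                 + A $ j $ 3 * y pi $ 1 + A $ j $ 4 * y pi $ 2"

definition Dom :: "complex^4^2 \<Rightarrow> (real \<Rightarrow> complex) \<Rightarrow> (real \<Rightarrow> complex) \<Rightarrow> (real \<Rightarrow> complex^2) set"
  where "Dom A p q = {y \<in> W11. Lop p q y \<in> H \<and> U A 1 y = 0 \<and> U A 2 y = 0}"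

text \<open>For an operator \<open>T\<close> in \<open>H\<close> with domain \<open>D\<close>, the number \<open>lam\<close> is in the resolvent set iff
  \<open>T - lam\<close> maps \<open>D\<close> onto \<open>H\<close>, is injective, and has a bounded inverse.\<close>

definition resolvent_set ::
    "(real \<Rightarrow> complex^2) set \<Rightarrow> ((real \<Rightarrow> complex^2) \<Rightarrow> real \<Rightarrow> complex^2) \<Rightarrow> complex set"
  where "resolvent_set D T = {lam.
    (\<forall>f\<in>H. \<exists>y\<in>D. AE x in Leb. T y x - lam *s y x = f x) \<and>
    (\<forall>y\<in>D. \<forall>z\<in>D. (AE x in Leb. T y x - lam *s y x = T z x - lam *s z x)
        \<longrightarrow> (AE x in Leb. y x = z x)) \<and>
    (\<exists>C. \<forall>y\<in>D. norm_H y \<le> C * norm_H (\<lambda>x. T y x - lam *s y x))}"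

definition spectrum ::
    "(real \<Rightarrow> complex^2) set \<Rightarrow> ((real \<Rightarrow> complex^2) \<Rightarrow> real \<Rightarrow> complex^2) \<Rightarrow> complex set"
  where "spectrum D T = - resolvent_set D T"

definition problem_spectrum ::
    "complex^4^2 \<Rightarrow> (real \<Rightarrow> complex) \<Rightarrow> (real \<Rightarrow> complex) \<Rightarrow> complex set"
  where "problem_spectrum A p q = spectrum (Dom A p q) (Lop p q)"

end

theory Submission
  imports Defs
begin

text \<open>The boundary conditions are equivalent to \<open>\<alpha> y(0) + \<beta> S y(\<pi>) = 0\<close>, where \<open>S\<close> swaps the two
  components and \<open>(\<alpha>, \<beta>) \<noteq> (0, 0)\<close> depends only on \<open>A\<close>. By the symmetry of \<open>p\<close> and \<open>q\<close>, if \<open>y\<close> solves the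
  equation with right-hand side \<open>f\<close>, then \<open>S y(\<pi> - x)\<close> solves it with right-hand side \<open>S f(\<pi> - x)\<close>. If
  \<open>\<alpha>\<^sup>2 = \<beta>\<^sup>2\<close>, then \<open>\<alpha> y(x) - \<beta> S y(\<pi> - x)\<close> satisfies the boundary conditions for every solution \<open>y\<close> of
  the homogeneous equation and is nonzero if \<open>y(\<pi>/2) = (1, 0)\<close>: every number is an eigenvalue. If
  \<open>\<alpha>\<^sup>2 \<noteq> \<beta>\<^sup>2\<close>, the same combination corrects the boundary values of an arbitrary solution, and for \<open>y\<close> in the
  domain \<open>u(x) = \<alpha> y(x) + \<beta> S y(\<pi> - x)\<close> vanishes at \<open>0\<close>, hence is controlled by Gronwall's inequality, while
  \<open>\<alpha> u(x) - \<beta> S u(\<pi> - x) = (\<alpha>\<^sup>2 - \<beta>\<^sup>2) y(x)\<close>: the spectrum is empty. So the spectrum depends only on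
  \<open>A\<close>. Membership in the domain is turned into an integral equation by the fundamental
  theorem of calculus for absolutely continuous functions, which follows from the Radon-Nikodym theorem.\<close>

text \<open>Put R y(x) = S y(\<pi> - x). R is an involution, and the symmetry of p and q makes it
  commute with the differential expression: reversing x changes the sign of y', and S changes the
  sign of B back. The boundary condition says that (\<alpha> + \<beta> R) y vanishes at 0, so both
  cases rest on the factorization (\<alpha> + \<beta> R)(\<alpha> - \<beta> R) = \<alpha>^2 -
  \<beta>^2; no characteristic determinant enters. The point \<pi>/2 is used because the reflection
  fixes it. The obstacle is regularity. Since p and q are merely integrable, the equation holds only
  almost everywhere, and existence and Gronwall bounds are proved for integral equations whose
  Lipschitz bound is an integrable function. The domain is given by \<epsilon>-\<delta> absolute
  continuity and a pointwise derivative; differentiability almost everywhere would not recover a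
  function from its derivative, hence the detour through variation and measures.\<close>

section \<open>Absolute continuity by increments over finite families of intervals\<close>

definition increments_less :: "real \<Rightarrow> real \<Rightarrow> (real \<Rightarrow> complex) \<Rightarrow> real \<Rightarrow> real \<Rightarrow> bool"
  where "increments_less a b f \<delta> \<epsilon> \<longleftrightarrow>
    (\<forall>(n::nat) (s::nat \<Rightarrow> real) (t::nat \<Rightarrow> real).
       (\<forall>i<n. a \<le> s i \<and> s i \<le> t i \<and> t i \<le> b) \<and>
       (\<forall>i<n. \<forall>j<n. i \<noteq> j \<longrightarrow> {s i<..<t i} \<inter> {s j<..<t j} = {}) \<and>
       (\<Sum>i<n. t i - s i) < \<delta>
       \<longrightarrow> (\<Sum>i<n. norm (f (t i) - f (s i))) < \<epsilon>)"

lemma abs_continuous_on_iff: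
  "abs_continuous_on a b f \<longleftrightarrow> (\<forall>\<epsilon>>0. \<exists>\<delta>>0. increments_less a b f \<delta> \<epsilon>)"
  unfolding abs_continuous_on_def increments_less_def ..

lemma abs_continuous_onE:
  assumes "abs_continuous_on a b f" "\<epsilon> > 0"
  obtains \<delta> where "\<delta> > 0" "increments_less a b f \<delta> \<epsilon>"
  using assms unfolding abs_continuous_on_iff by blast

lemma increments_lessI:
  assumes "\<And>(n::nat) s t. \<lbrakk>\<And>i. i < n \<Longrightarrow> a \<le> s i \<and> s i \<le> t i \<and> t i \<le> b;
      \<And>i j. \<lbrakk>i < n; j < n; i \<noteq> j\<rbrakk> \<Longrightarrow> {s i<..<t i} \<inter> {s j<..<t j} = {};
      (\<Sum>i<n. t i - s i) < \<delta>\<rbrakk> \<Longrightarrow> (\<Sum>i<n. norm (f (t i) - f (s i))) < \<epsilon>"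
  shows "increments_less a b f \<delta> \<epsilon>"
  unfolding increments_less_def by (intro allI impI, elim conjE, rule assms) auto

text \<open>The definition numbers its intervals, whereas the later arguments produce families
  indexed by pairs (variation) or by sets of reals (components of an open set); an enumeration of
  the index set mediates.\<close>

lemma increments_lessD:
  fixes s t :: "'i \<Rightarrow> real"
  assumes \<delta>: "increments_less a b f \<delta> \<epsilon>"
    and I: "finite I" "\<And>i. i \<in> I \<Longrightarrow> a \<le> s i \<and> s i \<le> t i \<and> t i \<le> b"
    and disj: "\<And>i j. \<lbrakk>i \<in> I; j \<in> I; i \<noteq> j\<rbrakk> \<Longrightarrow> {s i<..<t i} \<inter> {s j<..<t j} = {}"
    and small: "(\<Sum>i\<in>I. t i - s i) < \<delta>"
  shows "(\<Sum>i\<in>I. norm (f (t i) - f (s i))) < \<epsilon>"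
proof -
  obtain h where h: "bij_betw h {..<card I} I"
    using ex_bij_betw_nat_finite[OF I(1)] atLeast0LessThan by auto
  have hI: "h i \<in> I" if "i < card I" for i
    using h that by (auto simp: bij_betw_def)
  have inj: "h i \<noteq> h j" if "i < card I" "j < card I" "i \<noteq> j" for i j
    using h that by (auto simp: bij_betw_def inj_on_def)
  have "\<forall>i<card I. a \<le> s (h i) \<and> s (h i) \<le> t (h i) \<and> t (h i) \<le> b"
    using I(2) hI by blast
  moreover have "\<forall>i<card I. \<forall>j<card I. i \<noteq> j \<longrightarrow> {s (h i)<..<t (h i)} \<inter> {s (h j)<..<t (h j)} = {}"
    using disj hI inj by simp
  moreover have "(\<Sum>i<card I. t (h i) - s (h i)) < \<delta>"
    using small sum.reindex_bij_betw[OF h, of "\<lambda>i. t i - s i"] by simp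
  ultimately have "(\<Sum>i<card I. norm (f (t (h i)) - f (s (h i)))) < \<epsilon>"
    using \<delta>[unfolded increments_less_def, rule_format, of "card I" "\<lambda>i. s (h i)" "\<lambda>i. t (h i)"] by blast
  then show ?thesis
    using sum.reindex_bij_betw[OF h, of "\<lambda>i. norm (f (t i) - f (s i))"] by simp
qed

text \<open>Two dominating functions, because \<open>variation f a x - l (f x)\<close> is controlled
  by the variation and \<open>f\<close> together. For a Lipschitz image of one function both are
  taken equal.\<close>

lemma abs_continuous_on_dominated:
  assumes f: "abs_continuous_on a b f" and g: "abs_continuous_on a b g"
    and le: "\<And>x y. \<lbrakk>a \<le> x; x \<le> y; y \<le> b\<rbrakk> \<Longrightarrow> norm (h y - h x) \<le> C * (norm (f y - f x) + norm (g y - g x))"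
  shows "abs_continuous_on a b h"
  unfolding abs_continuous_on_iff
proof (intro allI impI)
  fix \<epsilon> :: real assume "\<epsilon> > 0"
  define e where "e = \<epsilon> / (2 * (\<bar>C\<bar> + 1))"
  have e: "e > 0" "\<bar>C\<bar> * (e + e) < \<epsilon>"
    using \<open>\<epsilon> > 0\<close> by (auto simp: e_def divide_simps)
  obtain d1 where d1: "d1 > 0" and D1: "increments_less a b f d1 e"
    using abs_continuous_onE[OF f e(1)] by blast
  obtain d2 where d2: "d2 > 0" and D2: "increments_less a b g d2 e"
    using abs_continuous_onE[OF g e(1)] by blast
  show "\<exists>\<delta>>0. increments_less a b h \<delta> \<epsilon>"
  proof (intro exI[of _ "min d1 d2"] conjI increments_lessI)
    show "min d1 d2 > 0" using d1 d2 by simp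
    fix n :: nat and s t :: "nat \<Rightarrow> real"
    assume *: "\<And>i. i < n \<Longrightarrow> a \<le> s i \<and> s i \<le> t i \<and> t i \<le> b"
       "\<And>i j. \<lbrakk>i < n; j < n; i \<noteq> j\<rbrakk> \<Longrightarrow> {s i<..<t i} \<inter> {s j<..<t j} = {}"
       "(\<Sum>i<n. t i - s i) < min d1 d2"
    have 1: "(\<Sum>i<n. norm (f (t i) - f (s i))) < e"
      by (rule increments_lessD[OF D1 finite_lessThan *(1) *(2)]) (use *(3) in auto)
    have 2: "(\<Sum>i<n. norm (g (t i) - g (s i))) < e"
      by (rule increments_lessD[OF D2 finite_lessThan *(1) *(2)]) (use *(3) in auto)
    have "norm (h (t i) - h (s i)) \<le> \<bar>C\<bar> * (norm (f (t i) - f (s i)) + norm (g (t i) - g (s i)))" if "i < n" for i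
    proof -
      have "norm (h (t i) - h (s i)) \<le> C * (norm (f (t i) - f (s i)) + norm (g (t i) - g (s i)))"
        using le *(1)[OF that] by auto
      also have "\<dots> \<le> \<bar>C\<bar> * (norm (f (t i) - f (s i)) + norm (g (t i) - g (s i)))"
        by (intro mult_right_mono) auto
      finally show ?thesis .
    qed
    then have "(\<Sum>i<n. norm (h (t i) - h (s i))) \<le> (\<Sum>i<n. \<bar>C\<bar> * (norm (f (t i) - f (s i)) + norm (g (t i) - g (s i))))"
      by (intro sum_mono) auto
    also have "\<dots> = \<bar>C\<bar> * ((\<Sum>i<n. norm (f (t i) - f (s i))) + (\<Sum>i<n. norm (g (t i) - g (s i))))"
      by (simp add: sum_distrib_left[symmetric] sum.distrib)
    also have "\<dots> \<le> \<bar>C\<bar> * (e + e)"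
      using 1 2 by (intro mult_left_mono) auto
    also have "\<dots> < \<epsilon>" by (rule e)
    finally show "(\<Sum>i<n. norm (h (t i) - h (s i))) < \<epsilon>" .
  qed
qed

lemma abs_continuous_on_imp_continuous_on:
  assumes "abs_continuous_on a b f"
  shows "continuous_on {a..b} f"
  unfolding continuous_on_iff
proof (intro ballI allI impI)
  fix x \<epsilon> :: real assume x: "x \<in> {a..b}" and "\<epsilon> > 0"
  obtain d where d: "d > 0" and D: "increments_less a b f d \<epsilon>"
    using abs_continuous_onE[OF assms \<open>\<epsilon> > 0\<close>] by blast
  have "dist (f y) (f x) < \<epsilon>" if "y \<in> {a..b}" "dist y x < d" for y
    using increments_lessD[OF D, of "{()}" "\<lambda>_. min x y" "\<lambda>_. max x y"] that x
    by (cases "x \<le> y") (auto simp: dist_norm norm_minus_commute)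
  then show "\<exists>d>0. \<forall>x'\<in>{a..b}. dist x' x < d \<longrightarrow> dist (f x') (f x) < \<epsilon>"
    using d by blast
qed

section \<open>The variation function\<close>

text \<open>A partition of \<open>[a,b]\<close> is an infinite monotone sequence of which only finitely many steps are summed.
  Truncating a sequence with \<open>min _ b\<close> and \<open>max _ b\<close> splits it at \<open>b\<close> without changing the number of steps.\<close>

definition part_seqs :: "real \<Rightarrow> real \<Rightarrow> (nat \<Rightarrow> real) set"
  where "part_seqs a b = {x. mono x \<and> range x \<subseteq> {a..b}}"

definition variation_sum :: "(real \<Rightarrow> complex) \<Rightarrow> (nat \<Rightarrow> real) \<Rightarrow> nat \<Rightarrow> real"
  where "variation_sum f x n = (\<Sum>i<n. norm (f (x (Suc i)) - f (x i)))"

definition bounded_variation :: "(real \<Rightarrow> complex) \<Rightarrow> real \<Rightarrow> real \<Rightarrow> bool"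
  where "bounded_variation f a b \<longleftrightarrow> (\<exists>C. \<forall>x\<in>part_seqs a b. \<forall>n. variation_sum f x n \<le> C)"

definition variation :: "(real \<Rightarrow> complex) \<Rightarrow> real \<Rightarrow> real \<Rightarrow> real"
  where "variation f a b = (SUP p\<in>part_seqs a b \<times> UNIV. case_prod (variation_sum f) p)"

lemma variation_sum_split:
  assumes "x \<in> part_seqs a c" "a \<le> b" "b \<le> c"
  obtains y z where "y \<in> part_seqs a b" "z \<in> part_seqs b c"
    "variation_sum f x n \<le> variation_sum f y n + variation_sum f z n"
proof
  let ?y = "\<lambda>i. min (x i) b" and ?z = "\<lambda>i. max (x i) b"
  show "?y \<in> part_seqs a b" "?z \<in> part_seqs b c"
    using assms unfolding part_seqs_def mono_def image_subset_iff
    by (simp_all add: min_le_iff_disj le_max_iff_disj) (meson order_trans linear)+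
  have "norm (f (x (Suc i)) - f (x i))
      \<le> norm (f (?y (Suc i)) - f (?y i)) + norm (f (?z (Suc i)) - f (?z i))" for i
  proof -
    have "x i \<le> x (Suc i)" using assms(1) by (simp add: part_seqs_def mono_def)
    \<comment> \<open>Only a step that crosses \<open>b\<close> is really cut; any other step
      survives in one truncation and is constant in the other.\<close>
    then consider "x (Suc i) \<le> b" | "b \<le> x i" | "x i \<le> b" "b \<le> x (Suc i)" by linarith
    then show ?thesis
    proof cases
      case 3
      then show ?thesis
        using norm_triangle_ineq[of "f (x (Suc i)) - f b" "f b - f (x i)"] by (simp add: min_def max_def)
    qed (use \<open>x i \<le> x (Suc i)\<close> in \<open>simp_all add: min_def max_def\<close>)
  qed
  then show "variation_sum f x n \<le> variation_sum f ?y n + variation_sum f ?z n"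
    unfolding variation_sum_def sum.distrib[symmetric] by (intro sum_mono) auto
qed

lemma variation_sum_join:
  assumes "x \<in> part_seqs a b" "y \<in> part_seqs b c" "a \<le> b" "b \<le> c"
  obtains z k where "z \<in> part_seqs a c" "variation_sum f x n + variation_sum f y m \<le> variation_sum f z k"
proof
  \<comment> \<open>The junction adds the step from \<open>x n\<close> to \<open>y 0\<close>, hence
    \<open>n + Suc m\<close> steps; its contribution is nonnegative and only helps.\<close>
  let ?z = "\<lambda>i. if i \<le> n then x i else y (i - Suc n)"
  have x: "mono x" "\<And>i. a \<le> x i \<and> x i \<le> b" and y: "mono y" "\<And>i. b \<le> y i \<and> y i \<le> c"
    using assms by (auto simp: part_seqs_def image_subset_iff)
  show "?z \<in> part_seqs a c"
    unfolding part_seqs_def mono_def image_subset_iff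
    using x y assms(3,4)
    by (auto simp: monoD intro: order_trans)
  have "variation_sum f ?z n = variation_sum f x n"
    by (auto simp: variation_sum_def intro!: sum.cong)
  then have "variation_sum f ?z (n + Suc m) = variation_sum f x n + norm (f (y 0) - f (x n)) + variation_sum f y m"
    by (induction m) (simp_all add: variation_sum_def Suc_diff_le)
  then show "variation_sum f x n + variation_sum f y m \<le> variation_sum f ?z (n + Suc m)"
    by simp
qed

lemma bounded_variation_combine:
  assumes "bounded_variation f a b" "bounded_variation f b c" "a \<le> b" "b \<le> c"
  shows "bounded_variation f a c"
proof -
  obtain C D where "\<And>x n. x \<in> part_seqs a b \<Longrightarrow> variation_sum f x n \<le> C"
    "\<And>x n. x \<in> part_seqs b c \<Longrightarrow> variation_sum f x n \<le> D"
    using assms unfolding bounded_variation_def by metis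
  then have "variation_sum f x n \<le> C + D" if "x \<in> part_seqs a c" for x n
    by (rule_tac variation_sum_split[OF that assms(3,4), of f n]) (smt (verit))
  then show ?thesis unfolding bounded_variation_def by blast
qed

lemma part_seqs_mono: "a' \<le> a \<Longrightarrow> b \<le> b' \<Longrightarrow> part_seqs a b \<subseteq> part_seqs a' b'"
  by (force simp: part_seqs_def)

lemma bounded_variation_subinterval:
  "bounded_variation f a' b' \<Longrightarrow> a' \<le> a \<Longrightarrow> b \<le> b' \<Longrightarrow> bounded_variation f a b"
  unfolding bounded_variation_def using part_seqs_mono by blast

lemma const_part_seqs: "a \<le> b \<Longrightarrow> (\<lambda>_. a) \<in> part_seqs a b"
  by (auto simp: part_seqs_def mono_def)

lemma variation_sum_le_variation:
  assumes "bounded_variation f a b" "x \<in> part_seqs a b"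
  shows "variation_sum f x n \<le> variation f a b"
proof -
  have "bdd_above (case_prod (variation_sum f) ` (part_seqs a b \<times> UNIV))"
    using assms(1) unfolding bounded_variation_def bdd_above_def by fastforce
  from cSUP_upper[OF _ this, of "(x, n)"] show ?thesis
    using assms(2) by (simp add: variation_def)
qed

lemma variation_le:
  assumes "a \<le> b" "\<And>x n. x \<in> part_seqs a b \<Longrightarrow> variation_sum f x n \<le> C"
  shows "variation f a b \<le> C"
  unfolding variation_def using assms const_part_seqs[of a b] by (intro cSUP_least) auto

lemma variation_approx:
  assumes "a \<le> b" "0 < (e::real)"
  obtains x n where "x \<in> part_seqs a b" "variation f a b < variation_sum f x n + e"
proof -
  have "\<not> (\<forall>x\<in>part_seqs a b. \<forall>n. variation_sum f x n \<le> variation f a b - e)"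
    using variation_le[of a b f "variation f a b - e"] assms by auto
  then obtain x n where "x \<in> part_seqs a b" "\<not> variation_sum f x n \<le> variation f a b - e" by blast
  then show ?thesis using that[of x n] by linarith
qed

lemma variation_additive:
  assumes bv: "bounded_variation f a c" and "a \<le> b" "b \<le> c"
  shows "variation f a b + variation f b c = variation f a c"
proof (rule antisym)
  have bv': "bounded_variation f a b" "bounded_variation f b c"
    using bounded_variation_subinterval[OF bv] assms by auto
  show "variation f a c \<le> variation f a b + variation f b c"
  proof (rule variation_le)
    fix x n assume "x \<in> part_seqs a c"
    then obtain y z where yz: "y \<in> part_seqs a b" "z \<in> part_seqs b c"
      "variation_sum f x n \<le> variation_sum f y n + variation_sum f z n"
      using variation_sum_split[of x a c b f n] assms by blast
    then show "variation_sum f x n \<le> variation f a b + variation f b c"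
      using variation_sum_le_variation[OF bv'(1) yz(1), of n] variation_sum_le_variation[OF bv'(2) yz(2), of n] by linarith
  qed (use assms in simp)
  have "variation f a b + variation f b c \<le> variation f a c + e" if "e > 0" for e :: real
  proof -
    obtain x n where x: "x \<in> part_seqs a b" "variation f a b < variation_sum f x n + e/2"
      using variation_approx[of a b "e/2" f] assms(2) half_gt_zero[OF \<open>e > 0\<close>] by blast
    obtain y m where y: "y \<in> part_seqs b c" "variation f b c < variation_sum f y m + e/2"
      using variation_approx[of b c "e/2" f] assms(3) half_gt_zero[OF \<open>e > 0\<close>] by blast
    obtain z k where "z \<in> part_seqs a c" "variation_sum f x n + variation_sum f y m \<le> variation_sum f z k"
      using variation_sum_join[OF x(1) y(1) assms(2,3), of f n m] .
    then show ?thesis using x y variation_sum_le_variation[OF bv, of z k] by argo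
  qed
  then show "variation f a b + variation f b c \<le> variation f a c"
    by (rule field_le_epsilon)
qed

lemma norm_diff_le_variation:
  assumes "bounded_variation f a b" "a \<le> b"
  shows "norm (f b - f a) \<le> variation f a b"
  using variation_sum_le_variation[OF assms(1), of "\<lambda>i. if i = 0 then a else b" 1] assms(2)
  by (simp add: part_seqs_def mono_def variation_sum_def image_subset_iff)

lemma part_seqs_disjoint_steps:
  assumes "mono (x :: nat \<Rightarrow> real)" "i \<noteq> j"
  shows "{x i<..<x (Suc i)} \<inter> {x j<..<x (Suc j)} = {}"
proof -
  have "x (Suc i) \<le> x j \<or> x (Suc j) \<le> x i"
    using assms by (metis Suc_leI linorder_neqE_nat monoD)
  then show ?thesis by auto
qed

text \<open>On an interval shorter than the \<delta> that belongs to \<epsilon> = 1 every variation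
  sum is below 1, and finitely many such intervals cover the whole.\<close>

lemma abs_continuous_on_imp_bounded_variation:
  assumes ac: "abs_continuous_on a b f"
  shows "bounded_variation f a b"
proof -
  obtain d where d: "d > 0" and D: "increments_less a b f d 1"
    using abs_continuous_onE[OF ac zero_less_one] by blast
  have small: "bounded_variation f u v" if "a \<le> u" "v \<le> b" "v - u < d" for u v
    unfolding bounded_variation_def
  proof (intro exI[of _ 1] ballI allI)
    fix x n assume "x \<in> part_seqs u v"
    then have x: "mono x" "\<And>i. u \<le> x i \<and> x i \<le> v" by (auto simp: part_seqs_def image_subset_iff)
    have "variation_sum f x n < 1"
      unfolding variation_sum_def
    proof (rule increments_lessD[OF D finite_lessThan])
      show "a \<le> x i \<and> x i \<le> x (Suc i) \<and> x (Suc i) \<le> b" for i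
        using x that by (meson monoD order_trans lessI less_imp_le)
      show "{x i<..<x (Suc i)} \<inter> {x j<..<x (Suc j)} = {}" if "i \<noteq> j" for i j
        using part_seqs_disjoint_steps[OF x(1)] that by blast
      show "(\<Sum>i<n. x (Suc i) - x i) < d"
        unfolding sum_lessThan_telescope using x(2)[of n] x(2)[of 0] that by linarith
    qed
    then show "variation_sum f x n \<le> 1" by simp
  qed
  show ?thesis
  proof (cases "a \<le> b")
    case False
    then show ?thesis using small[of a b] d by simp
  next
    case True
    \<comment> \<open>Steps of length \<open>d/2\<close> keep each piece strictly shorter than
      \<open>d\<close>; the minimum stops the walk at \<open>b\<close>.\<close>
    have *: "bounded_variation f a (min b (a + real k * (d/2)))" for k
    proof (induction k)
      case 0
      then show ?case using small[of a a] d True by (simp add: min_def)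
    next
      case (Suc k)
      let ?u = "min b (a + real k * (d/2))" and ?v = "min b (a + real (Suc k) * (d/2))"
      have uv: "a + real (Suc k) * (d/2) = (a + real k * (d/2)) + d/2" "0 \<le> real k * (d/2)"
        using d by (auto simp: algebra_simps)
      have "bounded_variation f ?u ?v" using d True uv by (intro small) linarith+
      moreover have "a \<le> ?u" "?u \<le> ?v" using d True uv by linarith+
      ultimately show ?case using bounded_variation_combine Suc by blast
    qed
    obtain k :: nat where "(b - a) / (d/2) \<le> real k" using real_arch_simple by blast
    then have "min b (a + real k * (d/2)) = b" using d by (simp add: field_simps)
    then show ?thesis using *[of k] by simp
  qed
qed

text \<open>Nearly optimal partitions of the given intervals together form a disjoint family of no
  greater total length, so the \<delta> of \<open>f\<close> for \<epsilon>/2 also serves its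
  variation.\<close>

lemma abs_continuous_on_variation:
  assumes ac: "abs_continuous_on a b f"
  shows "abs_continuous_on a b (\<lambda>x. complex_of_real (variation f a x))"
  unfolding abs_continuous_on_iff
proof (intro allI impI)
  fix \<epsilon> :: real assume "\<epsilon> > 0"
  note bv = abs_continuous_on_imp_bounded_variation[OF ac]
  obtain d where d: "d > 0" and D: "increments_less a b f d (\<epsilon>/2)"
    using abs_continuous_onE[OF ac half_gt_zero[OF \<open>\<epsilon> > 0\<close>]] by blast
  show "\<exists>\<delta>>0. increments_less a b (\<lambda>x. complex_of_real (variation f a x)) \<delta> \<epsilon>"
  proof (intro exI[of _ d] conjI increments_lessI)
    show "d > 0" by (rule d)
    fix n :: nat and s t :: "nat \<Rightarrow> real"
    assume *: "\<And>i. i < n \<Longrightarrow> a \<le> s i \<and> s i \<le> t i \<and> t i \<le> b"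
       "\<And>i j. \<lbrakk>i < n; j < n; i \<noteq> j\<rbrakk> \<Longrightarrow> {s i<..<t i} \<inter> {s j<..<t j} = {}"
       "(\<Sum>i<n. t i - s i) < d"
    \<comment> \<open>The \<open>n\<close> errors of the near-optimal partitions must add up to less
      than \<epsilon>/2.\<close>
    define e where "e = \<epsilon> / (2 * (real n + 1))"
    have e: "e > 0" "real n * e < \<epsilon>/2" using \<open>\<epsilon> > 0\<close> by (auto simp: e_def divide_simps)
    have bvi: "bounded_variation f (s i) (t i)" if "i < n" for i
      using bounded_variation_subinterval[OF bv] *(1)[OF that] by auto
    have "\<exists>x m. x \<in> part_seqs (s i) (t i) \<and> variation f (s i) (t i) < variation_sum f x m + e" if "i < n" for i
      using variation_approx[of "s i" "t i" e f] *(1)[OF that] e by metis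
    then obtain x m where xm: "\<And>i. i < n \<Longrightarrow> x i \<in> part_seqs (s i) (t i)"
      "\<And>i. i < n \<Longrightarrow> variation f (s i) (t i) < variation_sum f (x i) (m i) + e"
      by metis
    have x: "mono (x i)" "s i \<le> x i j" "x i j \<le> t i" if "i < n" for i j
      using xm(1)[OF that] by (auto simp: part_seqs_def image_subset_iff)
    \<comment> \<open>A pair consists of a given interval and a step of its partition. Two steps are
      disjoint by monotonicity within one partition, and by disjointness of the given intervals
      otherwise.\<close>
    let ?I = "SIGMA i:{..<n}. {..<m i}"
    have "(\<Sum>k\<in>?I. norm (f (x (fst k) (Suc (snd k))) - f (x (fst k) (snd k)))) < \<epsilon>/2"
    proof (rule increments_lessD[OF D])
      fix k assume "k \<in> ?I"
      then have k: "fst k < n" by auto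
      show "a \<le> x (fst k) (snd k) \<and> x (fst k) (snd k) \<le> x (fst k) (Suc (snd k)) \<and> x (fst k) (Suc (snd k)) \<le> b"
        using x(1)[OF k, THEN monoD, of "snd k" "Suc (snd k)"]
         x(2)[OF k, of "snd k"] x(3)[OF k, of "Suc (snd k)"] *(1)[OF k] by force
    next
      fix k l assume kl: "k \<in> ?I" "l \<in> ?I" "k \<noteq> l"
      then have k: "fst k < n" "fst l < n" by auto
      show "{x (fst k) (snd k)<..<x (fst k) (Suc (snd k))} \<inter> {x (fst l) (snd l)<..<x (fst l) (Suc (snd l))} = {}"
      proof (cases "fst k = fst l")
        case True
        then have "snd k \<noteq> snd l" using kl(3) by (simp add: prod_eq_iff)
        then show ?thesis using part_seqs_disjoint_steps[OF x(1)[OF k(1)]] True by auto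
      next
        case False
        then have "{s (fst k)<..<t (fst k)} \<inter> {s (fst l)<..<t (fst l)} = {}" using *(2) k by blast
        moreover have "{x (fst k) (snd k)<..<x (fst k) (Suc (snd k))} \<subseteq> {s (fst k)<..<t (fst k)}"
          using x(2)[OF k(1), of "snd k"] x(3)[OF k(1), of "Suc (snd k)"] by auto
        moreover have "{x (fst l) (snd l)<..<x (fst l) (Suc (snd l))} \<subseteq> {s (fst l)<..<t (fst l)}"
          using x(2)[OF k(2), of "snd l"] x(3)[OF k(2), of "Suc (snd l)"] by auto
        ultimately show ?thesis by blast
      qed
    next
      have "(\<Sum>k\<in>?I. x (fst k) (Suc (snd k)) - x (fst k) (snd k)) = (\<Sum>i<n. \<Sum>j<m i. x i (Suc j) - x i j)"
        by (subst sum.Sigma) (auto simp: case_prod_unfold)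
      also have "\<dots> = (\<Sum>i<n. x i (m i) - x i 0)" by (simp add: sum_lessThan_telescope)
      also have "\<dots> \<le> (\<Sum>i<n. t i - s i)"
        by (intro sum_mono diff_mono) (use x in auto)
      finally show "(\<Sum>k\<in>?I. x (fst k) (Suc (snd k)) - x (fst k) (snd k)) < d" using *(3) by linarith
    qed auto
    also have "(\<Sum>k\<in>?I. norm (f (x (fst k) (Suc (snd k))) - f (x (fst k) (snd k)))) = (\<Sum>i<n. variation_sum f (x i) (m i))"
      unfolding variation_sum_def by (subst sum.Sigma) (auto simp: case_prod_unfold)
    finally have 1: "(\<Sum>i<n. variation_sum f (x i) (m i)) < \<epsilon>/2" .
    have "norm (complex_of_real (variation f a (t i)) - complex_of_real (variation f a (s i))) \<le> variation_sum f (x i) (m i) + e" if "i < n" for i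
    proof -
      have st: "a \<le> s i" "s i \<le> t i" "t i \<le> b" using *(1)[OF that] by auto
      have "variation f a (t i) - variation f a (s i) = variation f (s i) (t i)"
        using variation_additive[OF bounded_variation_subinterval[OF bv], of a "t i" "s i"] st by simp
      moreover have "0 \<le> variation f (s i) (t i)"
        using norm_diff_le_variation[OF bvi[OF that] st(2)] norm_ge_zero order_trans by blast
      ultimately show ?thesis using xm(2)[OF that]
        by (metis abs_of_nonneg less_imp_le norm_of_real of_real_diff)
    qed
    then have "(\<Sum>i<n. norm (complex_of_real (variation f a (t i)) - complex_of_real (variation f a (s i))))
       \<le> (\<Sum>i<n. variation_sum f (x i) (m i) + e)"
      by (intro sum_mono) auto
    also have "\<dots> = (\<Sum>i<n. variation_sum f (x i) (m i)) + real n * e" by (simp add: sum.distrib)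
    also have "\<dots> < \<epsilon>" using 1 e by linarith
    finally show "(\<Sum>i<n. norm (complex_of_real (variation f a (t i)) - complex_of_real (variation f a (s i)))) < \<epsilon>" .
  qed
qed

section \<open>Absolutely continuous functions are indefinite integrals\<close>

text \<open>Applied to the components of an open set of small measure, where the measure supplies
  the bound \<open>r\<close> that makes infimum and supremum meaningful.\<close>

lemma bounded_open_interval:
  fixes C :: "real set"
  assumes C: "open C" "connected C" "C \<noteq> {}" and le: "\<And>x y. \<lbrakk>x \<in> C; y \<in> C; x \<le> y\<rbrakk> \<Longrightarrow> y - x \<le> r"
  shows "C = {Inf C<..<Sup C}" "Inf C \<le> Sup C"
proof -
  obtain c where c: "c \<in> C" using C(3) by blast
  have below: "bdd_below C"
    by (rule bdd_belowI[of _ "c - r"]) (use le c in \<open>smt (verit) \<close>)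
  have above: "bdd_above C"
    by (rule bdd_aboveI[of _ "c + r"]) (use le c in \<open>smt (verit) \<close>)
  show "Inf C \<le> Sup C" using c cInf_lower[OF c below] cSup_upper[OF c above] by linarith
  have "x \<noteq> Inf C \<and> x \<noteq> Sup C" if "x \<in> C" for x
  proof -
    obtain e where e: "e > 0" "ball x e \<subseteq> C"
      using C(1) \<open>x \<in> C\<close> open_contains_ball by blast
    then have "x - e/2 \<in> C" "x + e/2 \<in> C" by (auto simp: subset_iff dist_real_def)
    then show ?thesis using e(1) cInf_lower[OF _ below] cSup_upper[OF _ above] by fastforce
  qed
  then have "C \<subseteq> {Inf C<..<Sup C}"
    using cInf_lower[OF _ below] cSup_upper[OF _ above] by (force simp: less_le)
  moreover have "{Inf C<..<Sup C} \<subseteq> C"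
  proof
    fix x assume x: "x \<in> {Inf C<..<Sup C}"
    obtain u where "u \<in> C" "u < x" using x cInf_less_iff[OF C(3) below] by auto
    moreover obtain v where "v \<in> C" "x < v" using x less_cSup_iff[OF C(3) above] by auto
    ultimately show "x \<in> C"
      using C(2) connectedD_interval[of C u v x] by auto
  qed
  ultimately show "C = {Inf C<..<Sup C}" by blast
qed

text \<open>Absolute continuity speaks of finite families, but an open set may have infinitely many
  components. Finite unions of components exhaust the set, so continuity from below carries the
  bound over.\<close>

lemma emeasure_open_le:
  fixes U :: "real set"
  assumes U: "open U" "emeasure lborel U < ennreal \<delta>" and M: "sets M = sets borel"
    and fin: "\<And>(\<F>::real set set) s t. \<lbrakk>finite \<F>; \<And>C. C \<in> \<F> \<Longrightarrow> C = {s C<..<t C} \<and> s C \<le> t C;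
         disjoint \<F>; (\<Sum>C\<in>\<F>. t C - s C) < \<delta>\<rbrakk> \<Longrightarrow> emeasure M (\<Union>\<F>) \<le> \<epsilon>"
  shows "emeasure M U \<le> \<epsilon>"
proof -
  have comp: "C = {Inf C<..<Sup C} \<and> Inf C \<le> Sup C" if "C \<in> components U" for C
  proof -
    have C: "open C" "connected C" "C \<noteq> {}" "C \<subseteq> U"
      using open_components[OF U(1) that] in_components_connected[OF that]
        in_components_nonempty[OF that] in_components_subset[OF that] by simp_all
    have "y - x \<le> \<delta>" if "x \<in> C" "y \<in> C" "x \<le> y" for x y
    proof -
      have "{x..y} \<subseteq> U" using C that connected_contains_Icc by blast
      then have "emeasure lborel {x..y} \<le> emeasure lborel U"
        using U(1) by (intro emeasure_mono) auto
      then have "ennreal (y - x) < ennreal \<delta>" using U(2) that by simp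
      then show ?thesis using that by (simp add: ennreal_less_iff)
    qed
    then show ?thesis using bounded_open_interval[OF C(1-3), of \<delta>] by blast
  qed
  have disj: "disjoint (components U)"
    using pairwise_disjoint_components[of U] by (simp add: pairwise_def disjnt_def)
  have count: "countable (components U)"
    using disj U(1) open_components by (intro countable_disjoint_open_subsets) auto
  have le: "emeasure M (\<Union>\<F>) \<le> \<epsilon>" if "finite \<F>" "\<F> \<subseteq> components U" for \<F>
  proof (rule fin[of _ Inf Sup])
    show "C = {Inf C<..<Sup C} \<and> Inf C \<le> Sup C" if "C \<in> \<F>" for C using comp that \<open>\<F> \<subseteq> components U\<close> by blast
    show disj': "disjoint \<F>" using disj that(2) pairwise_subset by blast
    have "(\<Sum>C\<in>\<F>. emeasure lborel C) = emeasure lborel (\<Union>C\<in>\<F>. C)"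
    proof (rule sum_emeasure)
      show "(\<lambda>C. C) ` \<F> \<subseteq> sets lborel"
        using that(2) open_components[OF U(1)] by (auto intro!: borel_open)
      show "disjoint_family_on (\<lambda>C. C) \<F>" using disj' by (simp add: disjoint_family_on_def pairwise_def disjnt_def)
    qed (rule that)
    also have "\<dots> \<le> emeasure lborel U"
      using that U(1) in_components_subset by (intro emeasure_mono) auto
    also have "\<dots> < ennreal \<delta>" by (rule U)
    also have "(\<Sum>C\<in>\<F>. emeasure lborel C) = (\<Sum>C\<in>\<F>. ennreal (Sup C - Inf C))"
      using comp that(2) by (intro sum.cong refl) (metis emeasure_lborel_Ioo subsetD)
    also have "\<dots> = ennreal (\<Sum>C\<in>\<F>. Sup C - Inf C)"
      using comp that(2) by (intro sum_ennreal) auto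
    finally show "(\<Sum>C\<in>\<F>. Sup C - Inf C) < \<delta>"
      by (metis ennreal_leI not_le)
  qed (rule that)
  show ?thesis
  \<comment> \<open>An enumeration by \<open>from_nat_into\<close> covers exactly the components
    only if there is at least one.\<close>
  proof (cases "components U = {}")
    case True
    then have "\<Union>{} = U" using Union_components[of U] by (simp only:)
    then show ?thesis using le[of "{}"] by simp
  next
    case False
    define c where "c = from_nat_into (components U)"
    have c: "range c = components U" unfolding c_def using range_from_nat_into[OF False count] .
    have "(\<Union>n. \<Union>(c ` {..<n})) = \<Union>(range c)" by blast
    also have "\<dots> = U" unfolding c by (rule Union_components)
    finally have Ueq: "U = (\<Union>n. \<Union>(c ` {..<n}))" ..
    have "(SUP n. emeasure M (\<Union>(c ` {..<n}))) = emeasure M (\<Union>n. \<Union>(c ` {..<n}))"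
    proof (rule SUP_emeasure_incseq)
      have "\<And>n. c n \<in> sets borel" using c U(1) open_components by (metis borel_open rangeI)
      then show "range (\<lambda>n. \<Union>(c ` {..<n})) \<subseteq> sets M" unfolding M by (intro image_subsetI sets.finite_Union) auto
      show "incseq (\<lambda>n. \<Union>(c ` {..<n}))" by (force simp: incseq_def)
    qed
    moreover have "(SUP n. emeasure M (\<Union>(c ` {..<n}))) \<le> \<epsilon>"
      using c by (intro SUP_least le) auto
    ultimately show ?thesis using Ueq by simp
  qed
qed

text \<open>The Stieltjes measure of \<open>F\<close> gives an interval the increment of
  \<open>F\<close>. A Lebesgue null set lies in open sets of arbitrarily small length, whose
  Stieltjes measure is small by absolute continuity; so the measure has a Lebesgue density, and that
  density is the integrand.\<close>

lemma mono_abs_continuous_on_indefinite_integral: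
  fixes F :: "real \<Rightarrow> real"
  assumes "a \<le> b" and mono: "\<And>x y. \<lbrakk>a \<le> x; x \<le> y; y \<le> b\<rbrakk> \<Longrightarrow> F x \<le> F y"
    and ac: "abs_continuous_on a b (\<lambda>x. complex_of_real (F x))"
  shows "\<exists>g. g absolutely_integrable_on {a..b} \<and> (\<forall>x\<in>{a..b}. (g has_integral (F x - F a)) {a..x})"
proof -
  \<comment> \<open>\<open>interval_measure\<close> needs a monotone, right-continuous function on
    the whole line; clamping the argument extends \<open>F\<close> by constants.\<close>
  define c where "c x = max a (min b x)" for x
  have c: "c x \<in> {a..b}" "x \<le> y \<Longrightarrow> c x \<le> c y" "x \<in> {a..b} \<Longrightarrow> c x = x" for x y
    using \<open>a \<le> b\<close> by (auto simp: c_def)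
  define G where "G x = F (c x)" for x
  have monoG: "G x \<le> G y" if "x \<le> y" for x y
    using mono c(2)[OF that] c(1)[of x] c(1)[of y] by (auto simp: G_def)
  have "continuous_on {a..b} F"
    using continuous_on_Re[OF abs_continuous_on_imp_continuous_on[OF ac]] by simp
  then have contG: "continuous_on UNIV G"
    unfolding G_def c_def
    by (rule continuous_on_compose2) (use \<open>a \<le> b\<close> in \<open>auto intro!: continuous_intros\<close>)
  then have right: "continuous (at_right x) G" for x
    by (metis UNIV_I continuous_on_eq_continuous_at continuous_at_imp_continuous_within open_UNIV)
  define M where "M = interval_measure G"
  have M: "sets M = sets borel" by (simp add: M_def)
  have Ioc: "emeasure M {s<..t} = ennreal (G t - G s)" if "s \<le> t" for s t
    unfolding M_def using emeasure_interval_measure_Ioc[OF that, of G] monoG right by simp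
  have ac_M: "absolutely_continuous lborel M"
    unfolding absolutely_continuous_def
  proof
    fix N :: "real set" assume N: "N \<in> null_sets lborel"
    then have Nb: "N \<in> sets borel" by auto
    have le: "emeasure M N \<le> ennreal \<epsilon>" if "\<epsilon> > 0" for \<epsilon>
    proof -
      obtain \<delta> where \<delta>: "\<delta> > 0" "increments_less a b (\<lambda>x. complex_of_real (F x)) \<delta> \<epsilon>"
        using abs_continuous_onE[OF ac \<open>\<epsilon> > 0\<close>] .
      obtain U where U: "open U" "N \<subseteq> U" "emeasure lborel (U - N) < ennreal \<delta>"
        using outer_regular_lborel[OF Nb \<delta>(1)] by blast
      have "emeasure lborel U = emeasure lborel (U - N)"
        using N U(1) emeasure_Diff_null_set[OF N, of U] by simp
      with U have U': "emeasure lborel U < ennreal \<delta>" by simp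
      have "emeasure M U \<le> ennreal \<epsilon>"
      proof (rule emeasure_open_le[OF U(1) U' M])
        fix \<F> :: "real set set" and s t
        assume fin: "finite \<F>" and st: "\<And>C. C \<in> \<F> \<Longrightarrow> C = {s C<..<t C} \<and> s C \<le> t C"
          and disj: "disjoint \<F>" and sum: "(\<Sum>C\<in>\<F>. t C - s C) < \<delta>"
        have sub: "{c (s C)<..<c (t C)} \<subseteq> C" if "C \<in> \<F>" for C
        proof -
          have "{c (s C)<..<c (t C)} \<subseteq> {s C<..<t C}" using \<open>a \<le> b\<close> by (auto simp: c_def)
          then show ?thesis using st[OF that] by simp
        qed
        have "emeasure M (\<Union>\<F>) \<le> (\<Sum>C\<in>\<F>. emeasure M C)"
        proof -
          have "C \<in> sets M" if "C \<in> \<F>" for C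
          proof -
            have "open C" using st[OF that] open_greaterThanLessThan[of "s C" "t C"] by metis
            then show ?thesis by (simp add: M)
          qed
          then show ?thesis using emeasure_subadditive_finite[OF fin, of "\<lambda>C. C" M] by (simp add: subset_iff)
        qed
        also have "\<dots> \<le> (\<Sum>C\<in>\<F>. ennreal (G (t C) - G (s C)))"
        proof (rule sum_mono)
          fix C assume "C \<in> \<F>"
          then have "emeasure M C \<le> emeasure M {s C<..t C}"
            using st[OF \<open>C \<in> \<F>\<close>] greaterThanLessThan_subseteq_greaterThanAtMost_iff[of "s C" "t C" "s C" "t C"]
            by (intro emeasure_mono) (auto simp: M)
          then show "emeasure M C \<le> ennreal (G (t C) - G (s C))"
            using Ioc st[OF \<open>C \<in> \<F>\<close>] by simp
        qed
        also have "\<dots> = ennreal (\<Sum>C\<in>\<F>. G (t C) - G (s C))"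
          using monoG st by (intro sum_ennreal) auto
        also have "(\<Sum>C\<in>\<F>. G (t C) - G (s C)) = (\<Sum>C\<in>\<F>. norm (complex_of_real (F (c (t C))) - complex_of_real (F (c (s C)))))"
          using monoG st by (intro sum.cong) (auto simp: G_def norm_of_real simp flip: of_real_diff)
        also have "ennreal \<dots> \<le> ennreal \<epsilon>"
        proof (intro ennreal_leI less_imp_le, rule increments_lessD[OF \<delta>(2) fin])
          show "a \<le> c (s C) \<and> c (s C) \<le> c (t C) \<and> c (t C) \<le> b" if "C \<in> \<F>" for C
            using c(1)[of "s C"] c(1)[of "t C"] c(2) st[OF that] by auto
          show "{c (s C)<..<c (t C)} \<inter> {c (s D)<..<c (t D)} = {}" if "C \<in> \<F>" "D \<in> \<F>" "C \<noteq> D" for C D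
          proof -
            have "C \<inter> D = {}" using disj that by (simp add: pairwise_def disjnt_def)
            then show ?thesis using sub[OF that(1)] sub[OF that(2)] by blast
          qed
          \<comment> \<open>Clamping never lengthens an interval, so the clamped family still has
            total length below \<delta>.\<close>
          have "(\<Sum>C\<in>\<F>. c (t C) - c (s C)) \<le> (\<Sum>C\<in>\<F>. t C - s C)"
          proof (rule sum_mono)
            fix C assume "C \<in> \<F>"
            then have "s C \<le> t C" using st by blast
            then show "c (t C) - c (s C) \<le> t C - s C" unfolding c_def using \<open>a \<le> b\<close> by linarith
          qed
          then show "(\<Sum>C\<in>\<F>. c (t C) - c (s C)) < \<delta>" using sum by simp
        qed
        finally show "emeasure M (\<Union>\<F>) \<le> ennreal \<epsilon>"
          .
      qed
      moreover have "emeasure M N \<le> emeasure M U"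
        using U by (intro emeasure_mono) (auto simp: M)
      ultimately show ?thesis by simp
    qed
    have "emeasure M N \<le> 0"
      by (rule ennreal_le_epsilon) (use le in simp)
    then show "N \<in> null_sets M" using Nb by (auto simp: M null_sets_def)
  qed
  obtain g where g: "g \<in> borel_measurable lborel" "density lborel g = M"
    using sigma_finite_measure.Radon_Nikodym[OF sigma_finite_lborel ac_M] M by auto
  have nn: "(\<integral>\<^sup>+ t. g t * indicator {a..x} t \<partial>lborel) = ennreal (F x - F a)" if "x \<in> {a..b}" for x
  proof -
    have "(\<integral>\<^sup>+ t. g t * indicator {a..x} t \<partial>lborel) = emeasure M {a..x}"
      using g emeasure_density[OF g(1), of "{a..x}"] by simp
    also have "\<dots> = ennreal (G x - G a)"
      unfolding M_def using that monoG contG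
      by (intro emeasure_interval_measure_Icc) auto
    finally show ?thesis using that c(3)[of x] c(3)[of a] by (simp add: G_def)
  qed
  \<comment> \<open>The density is extended-valued but infinite on \<open>{a..b}\<close> only on a
    null set, since its integral there is finite; \<open>enn2real\<close> puts 0 there.\<close>
  define h where "h t = enn2real (g t)" for t
  have "AE t in lborel. g t * indicator {a..b} t \<noteq> \<infinity>"
    using nn[of b] \<open>a \<le> b\<close> g(1) by (intro nn_integral_noteq_infinite) auto
  then have AE: "AE t in lborel. g t * indicator {a..x} t = ennreal (h t * indicator {a..x} t)" if "x \<in> {a..b}" for x
    by eventually_elim (use that in \<open>auto simp: h_def indicator_def less_top split: if_splits\<close>)
  have int: "(h has_integral (F x - F a)) {a..x}" if "x \<in> {a..b}" for x
  proof -
    have "((\<lambda>t. h t * indicator {a..x} t) has_integral (F x - F a)) UNIV"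
    proof (rule nn_integral_has_integral)
      show "(\<lambda>t. h t * indicator {a..x} t) \<in> borel_measurable borel"
        using g(1) unfolding h_def by measurable
      show "0 \<le> F x - F a" using mono[of a x] that by auto
      show "(\<integral>\<^sup>+ t. h t * indicator {a..x} t \<partial>lborel) = ennreal (F x - F a)"
        using nn[OF that] nn_integral_cong_AE[OF AE[OF that]] by simp
    qed (simp add: h_def)
    then show ?thesis
      by (subst has_integral_restrict_UNIV[symmetric]) (simp add: indicator_def of_bool_def if_distrib cong: if_cong)
  qed
  have "h absolutely_integrable_on {a..b}"
    using int[of b] \<open>a \<le> b\<close> by (intro nonnegative_absolutely_integrable_1) (auto simp: h_def)
  then show ?thesis using int by blast
qed

text \<open>Jordan decomposition: for \<open>l\<close> the real or the imaginary part, both the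
  variation \<open>?T\<close> and \<open>?T x - l (f x)\<close> are nondecreasing and absolutely
  continuous, so the monotone case yields a density for each, and the difference of the densities
  belongs to \<open>l (f x)\<close>.\<close>

lemma abs_continuous_on_indefinite_integral:
  assumes ac: "abs_continuous_on a b f" and "a \<le> b"
  shows "\<exists>g. g absolutely_integrable_on {a..b} \<and> (\<forall>x\<in>{a..b}. (g has_integral (f x - f a)) {a..x})"
proof -
  let ?T = "variation f a"
  note bv = abs_continuous_on_imp_bounded_variation[OF ac]
  note acT = abs_continuous_on_variation[OF ac]
  have T: "norm (f y - f x) \<le> ?T y - ?T x" if "a \<le> x" "x \<le> y" "y \<le> b" for x y
    using norm_diff_le_variation[OF bounded_variation_subinterval[OF bv], of x y]
      variation_additive[OF bounded_variation_subinterval[OF bv], of a y x] that by simp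
  have *: "\<exists>g. g absolutely_integrable_on {a..b} \<and> (\<forall>x\<in>{a..b}. (g has_integral (l (f x) - l (f a))) {a..x})"
    if l: "\<And>z w. l (z - w) = l z - l w" "\<And>z. \<bar>l z\<bar> \<le> norm z" for l :: "complex \<Rightarrow> real"
  proof -
    have l': "\<bar>l (f y) - l (f x)\<bar> \<le> norm (f y - f x)" for x y using l by metis
    have "\<exists>g. g absolutely_integrable_on {a..b} \<and> (\<forall>x\<in>{a..b}. (g has_integral (?T x - ?T a)) {a..x})"
      by (rule mono_abs_continuous_on_indefinite_integral[OF assms(2) _ acT])
         (use T norm_ge_zero order_trans in \<open>metis diff_ge_0_iff_ge\<close>)
    moreover have "\<exists>g. g absolutely_integrable_on {a..b} \<and>
       (\<forall>x\<in>{a..b}. (g has_integral ((?T x - l (f x)) - (?T a - l (f a)))) {a..x})"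
    proof (rule mono_abs_continuous_on_indefinite_integral[OF assms(2)])
      show "?T x - l (f x) \<le> ?T y - l (f y)" if "a \<le> x" "x \<le> y" "y \<le> b" for x y
        using T[OF that] l'[of y x] by linarith
      show "abs_continuous_on a b (\<lambda>x. complex_of_real (?T x - l (f x)))"
      proof (rule abs_continuous_on_dominated[OF acT ac, of _ 1])
        fix x y
        show "norm (complex_of_real (?T y - l (f y)) - complex_of_real (?T x - l (f x)))
         \<le> 1 * (norm (complex_of_real (?T y) - complex_of_real (?T x)) + norm (f y - f x))"
          using l'[of y x] unfolding of_real_diff[symmetric] norm_of_real by (smt (verit))
      qed
    qed
    ultimately obtain g h where g: "g absolutely_integrable_on {a..b}"
        "\<And>x. x \<in> {a..b} \<Longrightarrow> (g has_integral (?T x - ?T a)) {a..x}"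
      and h: "h absolutely_integrable_on {a..b}"
        "\<And>x. x \<in> {a..b} \<Longrightarrow> (h has_integral ((?T x - l (f x)) - (?T a - l (f a)))) {a..x}"
      by blast
    have "((\<lambda>t. g t - h t) has_integral (l (f x) - l (f a))) {a..x}" if "x \<in> {a..b}" for x
      using has_integral_diff[OF g(2)[OF that] h(2)[OF that]] by (simp add: algebra_simps)
    then show ?thesis using set_integral_diff(1)[OF g(1) h(1)] by blast
  qed
  obtain g where g: "g absolutely_integrable_on {a..b}"
        "\<And>x. x \<in> {a..b} \<Longrightarrow> (g has_integral (Re (f x) - Re (f a))) {a..x}"
    using *[of Re] abs_Re_le_cmod by auto
  obtain h where h: "h absolutely_integrable_on {a..b}"
        "\<And>x. x \<in> {a..b} \<Longrightarrow> (h has_integral (Im (f x) - Im (f a))) {a..x}"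
    using *[of Im] abs_Im_le_cmod by auto
  have bl: "bounded_linear (\<lambda>r. r *\<^sub>R (1::complex))" "bounded_linear (\<lambda>r. r *\<^sub>R \<i>)"
    by (rule bounded_linear_scaleR_left)+
  define k where "k t = g t *\<^sub>R 1 + h t *\<^sub>R \<i>" for t
  have "k absolutely_integrable_on {a..b}"
    unfolding k_def
    using absolutely_integrable_linear[OF g(1) bl(1)] absolutely_integrable_linear[OF h(1) bl(2)]
    by (intro set_integral_add) (simp_all add: o_def)
  moreover have "(k has_integral (f x - f a)) {a..x}" if "x \<in> {a..b}" for x
  proof -
    have "(k has_integral ((Re (f x) - Re (f a)) *\<^sub>R 1 + (Im (f x) - Im (f a)) *\<^sub>R \<i>)) {a..x}"
      unfolding k_def
      using has_integral_linear[OF g(2)[OF that] bl(1)] has_integral_linear[OF h(2)[OF that] bl(2)]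
      by (intro has_integral_add) (simp_all add: o_def)
    moreover have "(Re (f x) - Re (f a)) *\<^sub>R 1 + (Im (f x) - Im (f a)) *\<^sub>R \<i> = f x - f a"
      by (simp add: complex_eq_iff)
    ultimately show ?thesis by simp
  qed
  ultimately show ?thesis by blast
qed

section \<open>Indefinite integrals are absolutely continuous and differentiable almost everywhere\<close>

lemma sum_integral_disjoint_le:
  fixes R :: "real \<Rightarrow> real"
  assumes R: "R integrable_on {a..b}" "\<And>x. x \<in> {a..b} \<Longrightarrow> 0 \<le> R x"
    and I: "finite I" "\<And>i. i \<in> I \<Longrightarrow> a \<le> s i \<and> s i \<le> t i \<and> t i \<le> b"
    and disj: "\<And>i j. \<lbrakk>i \<in> I; j \<in> I; i \<noteq> j\<rbrakk> \<Longrightarrow> {s i<..<t i} \<inter> {s j<..<t j} = {}"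
  shows "(\<Sum>i\<in>I. integral {s i..t i} R) \<le> integral {a..b} R"
proof -
  \<comment> \<open>Open intervals, because neighbours may share an endpoint, where two summands
    would count.\<close>
  define r where "r i x = (if x \<in> {s i<..<t i} then R x else 0)" for i x
  have r: "(r i has_integral (integral {s i..t i} R)) {a..b}" if "i \<in> I" for i
  proof -
    have sub: "{s i<..<t i} \<subseteq> {a..b}" using I(2)[OF that] by auto
    have "R integrable_on {s i..t i}"
      using R(1) I(2)[OF that] by (meson integrable_on_subinterval atLeastatMost_subset_iff)
    then have "(R has_integral (integral {s i..t i} R)) {s i<..<t i}"
      using has_integral_Icc_iff_Ioo integrable_integral by blast
    then show ?thesis
      unfolding r_def has_integral_restrict[OF sub] .
  qed
  have "(\<Sum>i\<in>I. integral {s i..t i} R) = integral {a..b} (\<lambda>x. \<Sum>i\<in>I. r i x)"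
    using has_integral_sum[OF I(1), of r "\<lambda>i. integral {s i..t i} R" "{a..b}"] r integral_unique by metis
  also have "\<dots> \<le> integral {a..b} R"
  proof (rule integral_le)
    show "(\<lambda>x. \<Sum>i\<in>I. r i x) integrable_on {a..b}"
      using r I(1) by (intro integrable_sum) auto
    fix x assume x: "x \<in> {a..b}"
    show "(\<Sum>i\<in>I. r i x) \<le> R x"
    proof (cases "\<exists>k\<in>I. x \<in> {s k<..<t k}")
      case True
      then obtain k where k: "k \<in> I" "x \<in> {s k<..<t k}" by blast
      then have "r i x = 0" if "i \<in> I - {k}" for i
        using disj[of i k] that unfolding r_def by (auto split: if_splits)
      then have "(\<Sum>i\<in>I. r i x) = r k x"
        using k(1) I(1) by (simp add: sum.remove[of I k])
      then show ?thesis using k by (simp add: r_def)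
    next
      case False
      then have "r i x = 0" if "i \<in> I" for i using that unfolding r_def by auto
      then show ?thesis using R(2)[OF x] by simp
    qed
  qed (rule R(1))
  finally show ?thesis .
qed

text \<open>The norm of \<open>g\<close> is split into its truncation at height \<open>k\<close> and
  a remainder \<open>R\<close>. For large \<open>k\<close> the remainder has integral below
  \<epsilon>/2 by dominated convergence; the bounded part contributes at most \<open>k\<close> times
  the total length, which then determines \<delta>.\<close>

lemma indefinite_integral_abs_continuous_on:
  assumes g: "g absolutely_integrable_on {a..b}"
    and f: "\<And>x. x \<in> {a..b} \<Longrightarrow> f x = f a + integral {a..x} g"
  shows "abs_continuous_on a b f"
  unfolding abs_continuous_on_iff
proof (intro allI impI)
  fix \<epsilon> :: real assume "\<epsilon> > 0"
  define G where "G k x = min (norm (g x)) (real k)" for k :: nat and x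
  have ng: "(\<lambda>x. norm (g x)) absolutely_integrable_on {a..b}"
    by (rule absolutely_integrable_norm[OF g, unfolded o_def])
  then have ngi: "(\<lambda>x. norm (g x)) integrable_on {a..b}" by (rule set_lebesgue_integral_eq_integral(1))
  have Gi: "G k integrable_on {a..b}" for k
  proof -
    have "(\<lambda>x. min (norm (g x)) (real k)) absolutely_integrable_on {a..b}"
      by (rule absolutely_integrable_min_1[OF ng]) (auto intro!: absolutely_integrable_continuous_real)
    then show ?thesis unfolding G_def by (rule set_lebesgue_integral_eq_integral(1))
  qed
  have "(\<lambda>k. integral {a..b} (G k)) \<longlonglongrightarrow> integral {a..b} (\<lambda>x. norm (g x))"
  proof (rule dominated_convergence(2)[OF Gi ngi])
    show "norm (G k x) \<le> norm (g x)" for k x by (simp add: G_def)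
    fix x
    obtain n :: nat where "norm (g x) \<le> real n" using real_arch_simple by blast
    then have "\<forall>\<^sub>F k in sequentially. G k x = norm (g x)"
      by (intro eventually_sequentiallyI[of n]) (auto simp: G_def)
    then show "(\<lambda>k. G k x) \<longlonglongrightarrow> norm (g x)" by (rule tendsto_eventually)
  qed
  then obtain k where k: "norm (integral {a..b} (G k) - integral {a..b} (\<lambda>x. norm (g x))) < \<epsilon>/2"
    using LIMSEQ_D[OF _ half_gt_zero[OF \<open>\<epsilon> > 0\<close>]] by blast
  define R where "R x = norm (g x) - G k x" for x
  have Ri: "R integrable_on {a..b}" unfolding R_def using ngi Gi by (intro integrable_diff)
  have R0: "0 \<le> R x" for x by (simp add: R_def G_def)
  have IR: "integral {a..b} R < \<epsilon>/2"
    using k integral_diff[OF ngi Gi[of k]] unfolding R_def real_norm_def by linarith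
  have inc: "norm (f v - f u) \<le> integral {u..v} R + real k * (v - u)" if "a \<le> u" "u \<le> v" "v \<le> b" for u v
  proof -
    have sub: "{u..v} \<subseteq> {a..b}" using that by auto
    have gi: "g integrable_on {a..b}" using g by (rule set_lebesgue_integral_eq_integral(1))
    have "integral {a..u} g + integral {u..v} g = integral {a..v} g"
      using gi that by (intro Henstock_Kurzweil_Integration.integral_combine)
         (auto intro: integrable_on_subinterval)
    then have "f v - f u = integral {u..v} g" using f[of u] f[of v] that by (simp add: algebra_simps)
    also have "norm \<dots> \<le> integral {u..v} (\<lambda>x. R x + real k)"
    proof (rule integral_norm_bound_integral)
      show "g integrable_on {u..v}" using gi sub by (rule integrable_on_subinterval)
      show "(\<lambda>x. R x + real k) integrable_on {u..v}"
        using integrable_on_subinterval[OF Ri sub] by (intro integrable_add) auto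
      show "norm (g x) \<le> R x + real k" for x by (simp add: R_def G_def)
    qed
    also have "\<dots> = integral {u..v} R + real k * (v - u)"
      using integrable_on_subinterval[OF Ri sub] that by (subst integral_add) auto
    finally show ?thesis .
  qed
  define \<delta> where "\<delta> = \<epsilon> / (2 * (real k + 1))"
  have \<delta>: "\<delta> > 0" "real k * \<delta> < \<epsilon>/2" using \<open>\<epsilon> > 0\<close> by (auto simp: \<delta>_def field_simps)
  show "\<exists>\<delta>>0. increments_less a b f \<delta> \<epsilon>"
  proof (intro exI[of _ \<delta>] conjI \<delta>(1) increments_lessI)
    fix n :: nat and s t :: "nat \<Rightarrow> real"
    assume *: "\<And>i. i < n \<Longrightarrow> a \<le> s i \<and> s i \<le> t i \<and> t i \<le> b"
       "\<And>i j. \<lbrakk>i < n; j < n; i \<noteq> j\<rbrakk> \<Longrightarrow> {s i<..<t i} \<inter> {s j<..<t j} = {}"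
       "(\<Sum>i<n. t i - s i) < \<delta>"
    have "(\<Sum>i<n. norm (f (t i) - f (s i))) \<le> (\<Sum>i<n. integral {s i..t i} R + real k * (t i - s i))"
      using inc *(1) by (intro sum_mono) auto
    also have "\<dots> = (\<Sum>i<n. integral {s i..t i} R) + real k * (\<Sum>i<n. t i - s i)"
      by (simp add: sum.distrib sum_distrib_left)
    also have "(\<Sum>i<n. integral {s i..t i} R) \<le> integral {a..b} R"
      using *(1,2) by (intro sum_integral_disjoint_le[OF Ri R0]) blast+
    also have "real k * (\<Sum>i<n. t i - s i) \<le> real k * \<delta>"
      using *(3) by (intro mult_left_mono) auto
    also have "integral {a..b} R + real k * \<delta> < \<epsilon>" using IR \<delta>(2) by linarith
    finally show "(\<Sum>i<n. norm (f (t i) - f (s i))) < \<epsilon>" by simp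
  qed
qed

text \<open>Lebesgue differentiation is available for averages over [x, x + k] only, which gives the
  right derivative. The left one comes from the same statement for the reflected function, at the
  price of a reflected exceptional set.\<close>

lemma indefinite_integral_has_vector_derivative_AE:
  fixes g :: "real \<Rightarrow> 'b::euclidean_space"
  assumes g: "g integrable_on {a..b}"
  shows "AE x in lebesgue_on {a..b}. ((\<lambda>x. integral {a..x} g) has_vector_derivative g x) (at x within {a..b})"
proof -
  \<comment> \<open>Extension by zero keeps the averages defined when x + k leaves the interval, and
    is invariant in form under reflection.\<close>
  define h where "h x = (if x \<in> {a..b} then g x else 0)" for x
  have hU: "h integrable_on UNIV" unfolding h_def using g integrable_restrict_UNIV by blast
  have h: "h integrable_on cbox u v" for u v
    using integrable_on_subcbox[OF hU, of u v] by simp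
  have h': "(\<lambda>x. h (- x)) integrable_on cbox u v" for u v
    using h[of "-v" "-u"] Henstock_Kurzweil_Integration.integrable_reflect_real[where f = h and a = "-v" and b = "-u"] by simp
  have ex: "\<exists>N. negligible N \<and> (\<forall>x e. x \<notin> N \<longrightarrow> 0 < e \<longrightarrow>
     (\<exists>d>0. \<forall>k. 0 < k \<and> k < d \<longrightarrow> norm (integral {x..x + k} f /\<^sub>R k - f x) < e))"
    if f: "\<And>u v. f integrable_on cbox u v" for f :: "real \<Rightarrow> 'b"
  proof (rule integrable_ccontinuous_explicit[OF f])
    fix N assume N: "negligible N" "\<And>x e. \<lbrakk>x \<notin> N; 0 < e\<rbrakk> \<Longrightarrow>
        \<exists>d>0. \<forall>k. 0 < k \<and> k < d \<longrightarrow> norm (integral (cbox x (x + k *\<^sub>R One)) f /\<^sub>R k ^ DIM(real) - f x) < e"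
    show ?thesis
      by (intro exI[of _ N] conjI allI impI N(1)) (drule (1) N(2), simp)
  qed
  obtain N1 where N1: "negligible N1" "\<And>x e. \<lbrakk>x \<notin> N1; 0 < e\<rbrakk> \<Longrightarrow>
     \<exists>d>0. \<forall>k. 0 < k \<and> k < d \<longrightarrow> norm (integral {x..x + k} h /\<^sub>R k - h x) < e"
    using ex[OF h] by blast
  obtain N2 where N2: "negligible N2" "\<And>x e. \<lbrakk>x \<notin> N2; 0 < e\<rbrakk> \<Longrightarrow>
     \<exists>d>0. \<forall>k. 0 < k \<and> k < d \<longrightarrow> norm (integral {x..x + k} (\<lambda>x. h (- x)) /\<^sub>R k - h (- x)) < e"
    using ex[OF h'] by blast
  have scale: "norm (J - k *\<^sub>R w) \<le> e * k" if "norm (J /\<^sub>R k - w) < e" "0 < k" for J w :: 'b and e k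
  proof -
    have "J - k *\<^sub>R w = k *\<^sub>R (J /\<^sub>R k - w)" using that by (simp add: algebra_simps)
    then have "norm (J - k *\<^sub>R w) = k * norm (J /\<^sub>R k - w)" using that by simp
    then show ?thesis using that by (simp add: mult.commute)
  qed
  have inc: "integral {a..y} g - integral {a..x} g = integral {x..y} h" if "a \<le> x" "x \<le> y" "y \<le> b" for x y
  proof -
    have "integral {a..x} g + integral {x..y} g = integral {a..y} g"
      using g that by (intro Henstock_Kurzweil_Integration.integral_combine)
         (auto intro: integrable_on_subinterval)
    moreover have "integral {x..y} g = integral {x..y} h"
      using that by (intro integral_cong) (auto simp: h_def)
    ultimately show ?thesis by (simp add: algebra_simps)
  qed
  have "((\<lambda>x. integral {a..x} g) has_vector_derivative g x) (at x within {a..b})"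
    if x: "x \<in> {a..b}" "x \<notin> N1" "x \<notin> uminus ` N2" for x
    unfolding has_vector_derivative_def has_derivative_within_alt
  proof (intro conjI allI impI bounded_linear_scaleR_left)
    fix e :: real assume "e > 0"
    obtain d1 where d1: "d1 > 0" "\<And>k. \<lbrakk>0 < k; k < d1\<rbrakk> \<Longrightarrow> norm (integral {x..x + k} h /\<^sub>R k - h x) < e"
      using N1(2)[OF x(2) \<open>e > 0\<close>] by blast
    have "- x \<notin> N2" using x(3) by force
    then obtain d2 where d2: "d2 > 0" "\<And>k. \<lbrakk>0 < k; k < d2\<rbrakk> \<Longrightarrow> norm (integral {-x..-x + k} (\<lambda>x. h (- x)) /\<^sub>R k - h x) < e"
      using N2(2)[OF \<open>- x \<notin> N2\<close> \<open>e > 0\<close>] unfolding minus_minus by blast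
    have refl: "integral {-x..-x + k} (\<lambda>x. h (- x)) = integral {x - k..x} h" for k
      using Henstock_Kurzweil_Integration.integral_reflect_real[of x "x - k" h] by simp
    have hx: "h x = g x" using x(1) by (simp add: h_def)
    show "\<exists>d>0. \<forall>y\<in>{a..b}. norm (y - x) < d \<longrightarrow>
       norm (integral {a..y} g - integral {a..x} g - (y - x) *\<^sub>R g x) \<le> e * norm (y - x)"
    proof (intro exI[of _ "min d1 d2"] conjI ballI impI)
      show "0 < min d1 d2" using d1 d2 by simp
      fix y assume y: "y \<in> {a..b}" "norm (y - x) < min d1 d2"
      consider "y = x" | "x < y" | "y < x" by linarith
      then show "norm (integral {a..y} g - integral {a..x} g - (y - x) *\<^sub>R g x) \<le> e * norm (y - x)"
      proof cases
        case 2
        then show ?thesis using scale[OF d1(2), of "y - x"] y x(1) inc[of x y] hx by simp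
      next
        case 3
        have "norm (integral {y..x} h - (x - y) *\<^sub>R h x) \<le> e * (x - y)"
          using scale[OF d2(2), of "x - y"] y 3 refl[of "x - y"] by simp
        moreover have "integral {a..y} g - integral {a..x} g - (y - x) *\<^sub>R g x = - (integral {y..x} h - (x - y) *\<^sub>R h x)"
          using inc[of y x] y x(1) 3 hx by (simp add: algebra_simps)
        ultimately show ?thesis using 3 by (metis abs_minus_commute abs_of_pos diff_gt_0_iff_gt norm_minus_cancel real_norm_def)
      qed simp
    qed
  qed
  moreover have "N1 \<union> uminus ` N2 \<in> null_sets lebesgue"
    using N1(1) negligible_differentiable_image_negligible[OF order_refl N2(1), of uminus]
    unfolding negligible_iff_null_sets[symmetric] by (simp add: negligible_Un differentiable_on_def)
  then have "AE x in lebesgue. x \<notin> N1 \<union> uminus ` N2" by (rule AE_not_in)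
  then have "AE x in lebesgue. x \<in> {a..b} \<longrightarrow> x \<notin> N1 \<union> uminus ` N2" by (rule eventually_mono) blast
  then have "AE x in lebesgue_on {a..b}. x \<notin> N1 \<union> uminus ` N2"
    using AE_restrict_space_iff[of "{a..b}" lebesgue "\<lambda>x. x \<notin> N1 \<union> uminus ` N2"] by simp
  moreover have "AE x in lebesgue_on {a..b}. x \<in> {a..b}" by (metis AE_space space_lebesgue_on)
  ultimately show ?thesis by (auto elim!: eventually_rev_mp)
qed

section \<open>Caratheodory differential equations\<close>

lemma AE_lebesgue_onE:
  assumes "AE x in lebesgue_on S. P x" "S \<in> sets lebesgue"
  obtains N where "negligible N" "\<And>x. x \<in> S - N \<Longrightarrow> P x"
proof -
  have "AE x in lebesgue. x \<in> S \<longrightarrow> P x"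
    using assms by (simp add: AE_restrict_space_iff)
  then obtain N where "N \<in> null_sets lebesgue" "{x \<in> space lebesgue. \<not> (x \<in> S \<longrightarrow> P x)} \<subseteq> N"
    unfolding eventually_ae_filter by blast
  then show ?thesis
    using that[of N] by (auto simp: negligible_iff_null_sets)
qed

text \<open>A chain rule for an \<open>N\<close> that is only absolutely continuous.
  \<open>exp\<close> is Lipschitz on the bounded range of \<open>K * N\<close>, so the composition
  is absolutely continuous and the integral of some \<open>g\<close>; comparing derivatives almost
  everywhere identifies \<open>g\<close>. The constant \<open>K\<close> of either sign serves
  weights that grow or decay.\<close>

lemma exp_indefinite_integral:
  fixes m :: "real \<Rightarrow> real"
  assumes m: "m absolutely_integrable_on {a..b}"
    and N: "\<And>x. x \<in> {a..b} \<Longrightarrow> N x = N a + integral {a..x} m"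
    and xy: "a \<le> x" "x \<le> y" "y \<le> b"
  shows "((\<lambda>t. K * m t * exp (K * N t)) has_integral (exp (K * N y) - exp (K * N x))) {x..y}"
\<comment> \<open>Derivatives within \<open>{a..b}\<close> are unique only if the interval is
  nondegenerate.\<close>
proof (cases "a < b")
  case False
  then have "x = y" using xy by linarith
  then show ?thesis by auto
next
  case True
  have mi: "m integrable_on {a..b}" using m by (rule set_lebesgue_integral_eq_integral(1))
  have acN: "abs_continuous_on a b (\<lambda>x. complex_of_real (N x))"
  proof (rule indefinite_integral_abs_continuous_on)
    have bl: "bounded_linear complex_of_real" by (rule bounded_linear_of_real)
    show "(\<lambda>t. complex_of_real (m t)) absolutely_integrable_on {a..b}"
      using absolutely_integrable_linear[OF m bl] by (simp add: o_def)
    show "complex_of_real (N x) = complex_of_real (N a) + integral {a..x} (\<lambda>t. complex_of_real (m t))"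
      if "x \<in> {a..b}" for x
    proof -
      have "m integrable_on {a..x}" using mi that by (auto intro: integrable_on_subinterval)
      from integral_linear[OF this bl] show ?thesis using N[OF that] by (simp add: o_def)
    qed
  qed
  have "continuous_on {a..b} N"
    using continuous_on_Re[OF abs_continuous_on_imp_continuous_on[OF acN]] by simp
  then have "bounded (N ` {a..b})" using compact_continuous_image compact_imp_bounded by blast
  then obtain c where "\<forall>x\<in>{a..b}. \<bar>N x\<bar> \<le> c" unfolding bounded_iff by auto
  then have c: "\<And>x. x \<in> {a..b} \<Longrightarrow> \<bar>N x\<bar> \<le> c" by blast
  define E where "E x = exp (K * N x)" for x
  have lip: "\<bar>exp u - exp v\<bar> \<le> exp r * \<bar>u - v\<bar>" if "\<bar>u\<bar> \<le> r" "\<bar>v\<bar> \<le> r" for u v r :: real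
  proof -
    have "norm (exp u - exp v) \<le> exp r * norm (u - v)"
      by (rule field_differentiable_bound[of "{-r..r}" exp exp])
         (use that in \<open>auto intro!: derivative_eq_intros\<close>)
    then show ?thesis by simp
  qed
  have "abs_continuous_on a b (\<lambda>x. complex_of_real (E x))"
  proof (rule abs_continuous_on_dominated[OF acN acN])
    fix x y assume "a \<le> x" "x \<le> y" "y \<le> b"
    then have "\<bar>N x\<bar> \<le> c" "\<bar>N y\<bar> \<le> c" using c by auto
    then have "\<bar>K * N y\<bar> \<le> \<bar>K\<bar> * c" "\<bar>K * N x\<bar> \<le> \<bar>K\<bar> * c"
      by (auto simp: abs_mult intro: mult_left_mono)
    then have "\<bar>E y - E x\<bar> \<le> exp (\<bar>K\<bar> * c) * \<bar>K * N y - K * N x\<bar>"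
      unfolding E_def by (rule lip)
    also have "\<dots> = (exp (\<bar>K\<bar> * c) * \<bar>K\<bar>) * \<bar>N y - N x\<bar>"
      by (simp add: abs_mult flip: right_diff_distrib)
    also have "\<dots> \<le> (exp (\<bar>K\<bar> * c) * \<bar>K\<bar>) * (\<bar>N y - N x\<bar> + \<bar>N y - N x\<bar>)"
      by (intro mult_left_mono) auto
    finally show "norm (complex_of_real (E y) - complex_of_real (E x))
       \<le> (exp (\<bar>K\<bar> * c) * \<bar>K\<bar>) * (norm (complex_of_real (N y) - complex_of_real (N x)) + norm (complex_of_real (N y) - complex_of_real (N x)))"
      unfolding of_real_diff[symmetric] norm_of_real .
  qed
  from abs_continuous_on_indefinite_integral[OF this] True
  obtain g where g: "g absolutely_integrable_on {a..b}"
    "\<And>x. x \<in> {a..b} \<Longrightarrow> (g has_integral (complex_of_real (E x) - complex_of_real (E a))) {a..x}" by auto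
  have gi: "g integrable_on {a..b}" using g(1) by (rule set_lebesgue_integral_eq_integral(1))
  have "AE x in lebesgue_on {a..b}. ((\<lambda>x. integral {a..x} g) has_vector_derivative g x) (at x within {a..b})
     \<and> ((\<lambda>x. integral {a..x} m) has_vector_derivative m x) (at x within {a..b})"
    using indefinite_integral_has_vector_derivative_AE[OF gi] indefinite_integral_has_vector_derivative_AE[OF mi]
    by eventually_elim auto
  then obtain Z where Z: "negligible Z"
    "\<And>x. x \<in> {a..b} - Z \<Longrightarrow> ((\<lambda>x. integral {a..x} g) has_vector_derivative g x) (at x within {a..b})
     \<and> ((\<lambda>x. integral {a..x} m) has_vector_derivative m x) (at x within {a..b})"
    by (rule AE_lebesgue_onE) auto
  have geq: "complex_of_real (K * m x * E x) = g x" if x: "x \<in> {a..b} - Z" for x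
  proof -
    have "((\<lambda>x. complex_of_real (E a) + integral {a..x} g) has_vector_derivative g x) (at x within {a..b})"
      using Z(2)[OF x] by (auto intro!: derivative_eq_intros)
    then have 1: "((\<lambda>x. complex_of_real (E x)) has_vector_derivative g x) (at x within {a..b})"
      by (rule has_vector_derivative_transform[rotated 2]) (use x integral_unique[OF g(2)] in auto)
    have "((\<lambda>x. N a + integral {a..x} m) has_real_derivative m x) (at x within {a..b})"
      using Z(2)[OF x] unfolding has_real_derivative_iff_has_vector_derivative by (auto intro!: derivative_eq_intros)
    then have "(N has_real_derivative m x) (at x within {a..b})"
      unfolding has_real_derivative_iff_has_vector_derivative
      by (rule has_vector_derivative_transform[rotated 2]) (use x in blast, rule N)
    then have "(E has_real_derivative K * m x * E x) (at x within {a..b})"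
      unfolding E_def by (auto intro!: derivative_eq_intros)
    then have 2: "((\<lambda>x. complex_of_real (E x)) has_vector_derivative complex_of_real (K * m x * E x)) (at x within {a..b})"
      unfolding has_real_derivative_iff_has_vector_derivative by (rule bounded_linear.has_vector_derivative[OF bounded_linear_of_real])
    show ?thesis
      using vector_derivative_unique_within_closed_interval[of a b x] True x 1 2 by auto
  qed
  have "integral {a..x} g + integral {x..y} g = integral {a..y} g"
    using gi xy by (intro Henstock_Kurzweil_Integration.integral_combine) (auto intro: integrable_on_subinterval)
  then have "integral {x..y} g = complex_of_real (E y - E x)"
    using integral_unique[OF g(2)] xy by (auto simp: algebra_simps)
  moreover have "g integrable_on {x..y}" using gi xy by (auto intro: integrable_on_subinterval)
  ultimately have "(g has_integral complex_of_real (E y - E x)) {x..y}"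
    by (metis integrable_integral)
  then have "((\<lambda>t. complex_of_real (K * m t * E t)) has_integral complex_of_real (E y - E x)) {x..y}"
    by (rule has_integral_spike[OF Z(1), rotated]) (use geq xy in auto)
  from has_integral_linear[OF this bounded_linear_Re] show ?thesis
    by (simp add: o_def E_def)
qed

lemma absolutely_integrable_continuous_mult:
  fixes m \<phi> :: "real \<Rightarrow> real"
  assumes "m absolutely_integrable_on {a..b}" "continuous_on {a..b} \<phi>"
  shows "(\<lambda>t. m t * \<phi> t) absolutely_integrable_on {a..b}"
proof -
  have "bounded (\<phi> ` {a..b})" using assms(2) compact_continuous_image compact_imp_bounded by blast
  moreover have "\<phi> \<in> borel_measurable (lebesgue_on {a..b})"
    using assms(2) by (intro continuous_imp_measurable_on_sets_lebesgue) auto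
  ultimately show ?thesis
    using absolutely_integrable_bounded_measurable_product_real[OF _ _ _ assms(1), of \<phi>]
    by (simp add: mult.commute)
qed

text \<open>The proof takes the supremum of \<open>\<phi>\<close> against the weight \<open>exp (-2 M)\<close>, \<open>M\<close> the indefinite integral of
  \<open>m\<close>: by \<open>exp_indefinite_integral\<close> the integral term is then at most half of that supremum.\<close>

lemma gronwall_integrable:
  fixes m \<phi> :: "real \<Rightarrow> real"
  assumes m: "m absolutely_integrable_on {a..b}" "\<And>x. x \<in> {a..b} \<Longrightarrow> 0 \<le> m x"
    and \<phi>: "continuous_on {a..b} \<phi>"
    and le: "\<And>x. x \<in> {a..b} \<Longrightarrow> \<phi> x \<le> C + integral {a..x} (\<lambda>t. m t * \<phi> t)"
    and x: "x \<in> {a..b}" and "0 \<le> C"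
  shows "\<phi> x \<le> 2 * C * exp (2 * integral {a..b} m)"
proof -
  define M where "M x = integral {a..x} m" for x
  have mi: "m integrable_on {a..b}" using m(1) by (rule set_lebesgue_integral_eq_integral(1))
  have M: "M x = M a + integral {a..x} m" for x by (simp add: M_def)
  have contM: "continuous_on {a..b} M"
    unfolding M_def by (rule indefinite_integral_continuous_1[OF mi])
  have M0: "0 \<le> M x" "M x \<le> M b" if "x \<in> {a..b}" for x
  proof -
    have mx: "m integrable_on {a..x}" using mi that by (auto intro: integrable_on_subinterval)
    show "0 \<le> M x" unfolding M_def using that m(2) by (intro integral_nonneg[OF mx]) auto
    show "M x \<le> M b" unfolding M_def using that m(2) by (intro integral_subset_le mx mi) auto
  qed
  have "continuous_on {a..b} (\<lambda>x. \<phi> x * exp (- 2 * M x))"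
    by (intro continuous_intros \<phi> contM)
  then obtain z where z: "z \<in> {a..b}" "\<And>x. x \<in> {a..b} \<Longrightarrow> \<phi> x * exp (- 2 * M x) \<le> \<phi> z * exp (- 2 * M z)"
    using continuous_attains_sup[of "{a..b}" "\<lambda>x. \<phi> x * exp (- 2 * M x)"] x by auto
  define S where "S = \<phi> z * exp (- 2 * M z)"
  have S: "\<phi> x \<le> S * exp (2 * M x)" if "x \<in> {a..b}" for x
  proof -
    have "\<phi> x = \<phi> x * exp (- 2 * M x) * exp (2 * M x)" by (simp add: exp_minus)
    also have "\<dots> \<le> S * exp (2 * M x)"
      using z(2)[OF that] by (intro mult_right_mono) (auto simp: S_def)
    finally show ?thesis .
  qed
  have zi: "(\<lambda>t. m t * \<phi> t) integrable_on {a..z}"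
    using set_lebesgue_integral_eq_integral(1)[OF absolutely_integrable_continuous_mult[OF m(1) \<phi>]] z(1)
    by (auto intro: integrable_on_subinterval)
  have I: "((\<lambda>t. S/2 * (2 * m t * exp (2 * M t))) has_integral (S/2 * (exp (2 * M z) - exp (2 * M a)))) {a..z}"
    using z(1) by (intro has_integral_mult_right exp_indefinite_integral[OF m(1) M]) auto
  have "integral {a..z} (\<lambda>t. m t * \<phi> t) \<le> S/2 * (exp (2 * M z) - exp (2 * M a))"
  proof (rule has_integral_le[OF integrable_integral[OF zi] I])
    fix t assume t: "t \<in> {a..z}"
    then have "m t * \<phi> t \<le> m t * (S * exp (2 * M t))"
      using z(1) S[of t] m(2)[of t] by (intro mult_left_mono) auto
    then show "m t * \<phi> t \<le> S / 2 * (2 * m t * exp (2 * M t))" by (simp add: mult_ac)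
  qed
  \<comment> \<open>The hypothesis at the maximum point \<open>z\<close> becomes an inequality for
    \<open>S\<close> alone. If \<open>S\<close> is positive, \<open>exp (2 * M z)\<close> is at
    least 1 and half of the left side absorbs the term with \<open>S/2\<close>.\<close>
  then have "\<phi> z \<le> C + S/2 * (exp (2 * M z) - 1)"
    using le[OF z(1)] by (simp add: M_def)
  moreover have "\<phi> z = S * exp (2 * M z)" by (simp add: S_def exp_minus)
  ultimately have Sz: "S * exp (2 * M z) \<le> C + S/2 * exp (2 * M z) - S/2"
    by (simp add: algebra_simps)
  have "S \<le> 2 * C"
  proof (cases "S \<le> 0")
    case False
    have "1 \<le> exp (2 * M z)" using M0[OF z(1)] by simp
    then have "S \<le> S * exp (2 * M z)" using False by simp
    with Sz have "S \<le> 2 * C - S" by linarith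
    then show ?thesis using False by linarith
  qed (use \<open>0 \<le> C\<close> in linarith)
  then have "S * exp (2 * M x) \<le> 2 * C * exp (2 * M x)" by (intro mult_right_mono) auto
  also have "\<dots> \<le> 2 * C * exp (2 * M b)" using M0[OF x] \<open>0 \<le> C\<close> by (intro mult_left_mono) auto
  finally show ?thesis using S[OF x] by (simp add: M_def)
qed

text \<open>In the supremum norm weighted with \<open>exp (-2 \<bar>N\<bar>)\<close>, where \<open>N\<close> is the integral of \<open>m\<close> from \<open>x0\<close>, the Picard
  operator is a contraction with factor \<open>1/2\<close> on the whole interval, on both sides of \<open>x0\<close>.\<close>

lemma caratheodory_exists:
  fixes F :: "real \<Rightarrow> 'a \<Rightarrow> 'a::euclidean_space" and m :: "real \<Rightarrow> real"
  assumes m: "m absolutely_integrable_on {a..b}" "\<And>x. x \<in> {a..b} \<Longrightarrow> 0 \<le> m x"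
    and F: "\<And>y. continuous_on {a..b} y \<Longrightarrow> (\<lambda>s. F s (y s)) integrable_on {a..b}"
    and lip: "\<And>s u v. s \<in> {a..b} \<Longrightarrow> norm (F s u - F s v) \<le> m s * norm (u - v)"
    and x0: "x0 \<in> {a..b}"
  shows "\<exists>y. continuous_on {a..b} y \<and>
    (\<forall>x\<in>{a..b}. y x = v + integral {a..x} (\<lambda>s. F s (y s)) - integral {a..x0} (\<lambda>s. F s (y s)))"
proof -
  have mi: "m integrable_on {a..b}" using m(1) by (rule set_lebesgue_integral_eq_integral(1))
  define N where "N x = integral {a..x} m - integral {a..x0} m" for x
  have N: "N x = N a + integral {a..x} m" for x by (simp add: N_def)
  have contN: "continuous_on {a..b} N"
    unfolding N_def by (intro continuous_intros indefinite_integral_continuous_1[OF mi])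
  have N_mono: "N x \<le> N y" if "a \<le> x" "x \<le> y" "y \<le> b" for x y
  proof -
    have "integral {a..x} m \<le> integral {a..y} m"
      using that m(2) mi by (intro integral_subset_le) (auto intro: integrable_on_subinterval)
    then show ?thesis by (simp add: N_def)
  qed
  have N0: "N x0 = 0" by (simp add: N_def)
  define W where "W x = exp (- 2 * \<bar>N x\<bar>)" for x
  have W: "W x > 0" for x by (simp add: W_def)
  have contW: "continuous_on {a..b} W" unfolding W_def by (intro continuous_intros contN)
  \<comment> \<open>Clamping turns functions on \<open>{a..b}\<close> into bounded continuous
    functions on the line, a complete metric space for Banach's theorem.\<close>
  define c where "c x = max a (min b x)" for x
  have c: "c x \<in> {a..b}" "x \<in> {a..b} \<Longrightarrow> c x = x" for x using x0 by (auto simp: c_def)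
  have contc: "continuous_on UNIV c" unfolding c_def by (intro continuous_intros)
  \<comment> \<open>A point \<open>u\<close> of the space stands for the weighted function
    \<open>W s *\<^sub>R y s\<close>; dividing by the weight recovers \<open>y\<close>, and the
    weighted norm becomes the ordinary distance.\<close>
  define Y where "Y u s = apply_bcontfun u s /\<^sub>R W s" for u :: "real \<Rightarrow>\<^sub>C 'a" and s
  have contY: "continuous_on {a..b} (Y u)" for u
    unfolding Y_def using W by (intro continuous_intros contW) (auto simp: less_imp_neq[symmetric])
  define I where "I u x = integral {a..x} (\<lambda>s. F s (Y u s))" for u x
  have Fi: "(\<lambda>s. F s (Y u s)) integrable_on {a..b}" for u by (rule F[OF contY])
  define h where "h u x = W x *\<^sub>R (v + I u x - I u x0)" for u x
  have conth: "continuous_on {a..b} (h u)" for u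
    unfolding h_def I_def by (intro continuous_intros contW indefinite_integral_continuous_1[OF Fi])
  have hb: "(\<lambda>x. h u (c x)) \<in> bcontfun" for u
  proof -
    have "continuous_on UNIV (\<lambda>x. h u (c x))"
      by (rule continuous_on_compose2[OF conth contc]) (use c in auto)
    moreover have "bounded (h u ` {a..b})"
      using conth compact_continuous_image compact_imp_bounded by blast
    then have "bounded (range (\<lambda>x. h u (c x)))"
      by (rule bounded_subset) (use c in auto)
    ultimately show ?thesis by (simp add: bcontfun_def)
  qed
  define \<Phi> where "\<Phi> u = Bcontfun (\<lambda>x. h u (c x))" for u
  have \<Phi>: "apply_bcontfun (\<Phi> u) x = h u (c x)" for u x
    unfolding \<Phi>_def using Bcontfun_inverse[OF hb] by metis
  \<comment> \<open>The unweighted difference grows at most like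
    \<open>exp (2 * \<bar>N s\<bar>)\<close>. Integrating this against \<open>m\<close> produces the
    factor 1/2, and multiplication by \<open>W t\<close> cancels the exponential.\<close>
  have bound: "norm ((I u t - I u' t) - (I u x0 - I u' x0)) \<le> dist u u' / 2 * (exp (2 * \<bar>N t\<bar>) - 1)"
    if t: "t \<in> {a..b}" for u u' t
  proof -
    let ?D = "\<lambda>s. F s (Y u s) - F s (Y u' s)"
    have Di: "?D integrable_on {a..b}" by (intro integrable_diff Fi)
    have inc: "(I u y - I u' y) - (I u x - I u' x) = integral {x..y} ?D" if "a \<le> x" "x \<le> y" "y \<le> b" for x y
    proof -
      have "I u z - I u' z = integral {a..z} ?D" if "z \<in> {a..b}" for z
        unfolding I_def using that
        by (intro integral_diff[symmetric] integrable_on_subinterval[OF Fi]) auto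
      moreover have "integral {a..x} ?D + integral {x..y} ?D = integral {a..y} ?D"
        using Di that by (intro Henstock_Kurzweil_Integration.integral_combine) (auto intro: integrable_on_subinterval)
      ultimately show ?thesis using that by (simp add: algebra_simps)
    qed
    have D: "norm (?D s) \<le> dist u u' * (m s * exp (2 * \<bar>N s\<bar>))" if s: "s \<in> {a..b}" for s
    proof -
      have "Y u s - Y u' s = exp (2 * \<bar>N s\<bar>) *\<^sub>R (u s - u' s)"
        by (simp add: Y_def W_def exp_minus scaleR_diff_right)
      then have "norm (Y u s - Y u' s) = exp (2 * \<bar>N s\<bar>) * dist (u s) (u' s)" by (simp add: dist_norm)
      also have "\<dots> \<le> exp (2 * \<bar>N s\<bar>) * dist u u'" by (intro mult_left_mono dist_bounded) auto
      finally have "m s * norm (Y u s - Y u' s) \<le> m s * (exp (2 * \<bar>N s\<bar>) * dist u u')"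
        using m(2)[OF s] by (rule mult_left_mono)
      then show ?thesis using lip[OF s, of "Y u s" "Y u' s"] by (simp add: mult_ac)
    qed
    show ?thesis
    proof (cases "x0 \<le> t")
      case True
      have "((\<lambda>s. dist u u' / 2 * (2 * m s * exp (2 * N s))) has_integral
          (dist u u' / 2 * (exp (2 * N t) - exp (2 * N x0)))) {x0..t}"
        using x0 t True by (intro has_integral_mult_right exp_indefinite_integral[OF m(1) N]) auto
      then have int: "(\<lambda>s. dist u u' / 2 * (2 * m s * exp (2 * N s))) integrable_on {x0..t}"
          "integral {x0..t} (\<lambda>s. dist u u' / 2 * (2 * m s * exp (2 * N s))) = dist u u' / 2 * (exp (2 * N t) - 1)"
        unfolding N0 mult_zero_right exp_zero by (blast intro: integral_unique has_integral_integrable)+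
      have "norm (integral {x0..t} ?D) \<le> dist u u' / 2 * (exp (2 * N t) - 1)"
        unfolding int(2)[symmetric]
      proof (rule integral_norm_bound_integral[OF _ int(1)])
        show "?D integrable_on {x0..t}" using Di x0 t by (auto intro: integrable_on_subinterval)
        show "norm (?D s) \<le> dist u u' / 2 * (2 * m s * exp (2 * N s))" if "s \<in> {x0..t}" for s
          using D[of s] N_mono[of x0 s] N0 x0 t that by auto
      qed
      then show ?thesis using inc[of x0 t] N_mono[of x0 t] N0 x0 t True by auto
    next
      case False
      \<comment> \<open>To the left of \<open>x0\<close> the function \<open>N\<close> is
        nonpositive, so the exponent has constant -2 and the prefactor changes sign.\<close>
      have "((\<lambda>s. - dist u u' / 2 * ((-2) * m s * exp ((-2) * N s))) has_integral
          (- dist u u' / 2 * (exp ((-2) * N x0) - exp ((-2) * N t)))) {t..x0}"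
        using x0 t False by (intro has_integral_mult_right exp_indefinite_integral[OF m(1) N]) auto
      then have int: "(\<lambda>s. - dist u u' / 2 * ((-2) * m s * exp ((-2) * N s))) integrable_on {t..x0}"
          "integral {t..x0} (\<lambda>s. - dist u u' / 2 * ((-2) * m s * exp ((-2) * N s))) = - dist u u' / 2 * (1 - exp ((-2) * N t))"
        unfolding N0 mult_zero_right exp_zero by (blast intro: integral_unique has_integral_integrable)+
      have "norm (integral {t..x0} ?D) \<le> - dist u u' / 2 * (1 - exp ((-2) * N t))"
        unfolding int(2)[symmetric]
      proof (rule integral_norm_bound_integral[OF _ int(1)])
        show "?D integrable_on {t..x0}" using Di x0 t by (auto intro: integrable_on_subinterval)
        show "norm (?D s) \<le> - dist u u' / 2 * ((-2) * m s * exp ((-2) * N s))" if "s \<in> {t..x0}" for s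
          using D[of s] N_mono[of s x0] N0 x0 t that by auto
      qed
      moreover have "norm ((I u t - I u' t) - (I u x0 - I u' x0)) = norm (integral {t..x0} ?D)"
        using inc[of t x0] x0 t False by (subst norm_minus_commute) simp
      ultimately show ?thesis using N_mono[of t x0] N0 x0 t False by (auto simp: algebra_simps)
    qed
  qed
  have "dist (\<Phi> u) (\<Phi> u') \<le> 1/2 * dist u u'" for u u'
  proof (rule dist_bound)
    fix x
    let ?t = "c x"
    have "dist (\<Phi> u x) (\<Phi> u' x) = norm (W ?t *\<^sub>R ((I u ?t - I u' ?t) - (I u x0 - I u' x0)))"
      unfolding \<Phi> h_def dist_norm by (simp add: algebra_simps)
    also have "\<dots> = W ?t * norm ((I u ?t - I u' ?t) - (I u x0 - I u' x0))" using W[of ?t] by simp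
    also have "\<dots> \<le> W ?t * (dist u u' / 2 * (exp (2 * \<bar>N ?t\<bar>) - 1))"
      using bound[OF c(1)] W by (intro mult_left_mono) (auto intro: less_imp_le)
    also have "\<dots> = dist u u' / 2 * (1 - W ?t)"
      by (simp add: W_def exp_minus field_simps)
    also have "\<dots> \<le> dist u u' / 2 * 1" using W[of ?t] by (intro mult_left_mono) auto
    finally show "dist (\<Phi> u x) (\<Phi> u' x) \<le> 1/2 * dist u u'" by simp
  qed
  then obtain u where u: "\<Phi> u = u"
    using banach_fix_type[of "1/2" \<Phi>] by auto
  show ?thesis
  proof (intro exI[of _ "Y u"] conjI ballI contY)
    fix x assume "x \<in> {a..b}"
    then have "apply_bcontfun u x = h u x" using \<Phi>[of u x] c(2) u by simp
    then show "Y u x = v + integral {a..x} (\<lambda>s. F s (Y u s)) - integral {a..x0} (\<lambda>s. F s (Y u s))"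
      unfolding Y_def[of u x] h_def I_def using W[of x] by simp
  qed
qed

section \<open>Vector-valued functions on the interval\<close>

lemma absolutely_integrable_on_iff_integrable:
  fixes f :: "'a::euclidean_space \<Rightarrow> 'b::euclidean_space"
  assumes "S \<in> sets lebesgue"
  shows "f absolutely_integrable_on S \<longleftrightarrow> integrable (lebesgue_on S) f"
  using integrable_restrict_space[of S lebesgue f] assms by (simp add: set_integrable_def)

lemma L1_iff: "f \<in> L1 \<longleftrightarrow> f absolutely_integrable_on {0..pi}"
  by (simp add: L1_def absolutely_integrable_on_iff_integrable)

lemma bounded_linear_axis: "bounded_linear (axis i :: complex \<Rightarrow> complex^'n)"
proof -
  have "linear (axis i :: complex \<Rightarrow> complex^'n)"
    by (rule linearI) (simp_all add: axis_def vec_eq_iff)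
  then show ?thesis by (simp add: linear_conv_bounded_linear)
qed

lemma absolutely_integrable_vec:
  fixes f :: "'a::euclidean_space \<Rightarrow> complex^'n"
  assumes "\<And>i. (\<lambda>x. f x $ i) absolutely_integrable_on S"
  shows "f absolutely_integrable_on S"
proof -
  have "(\<lambda>x. \<Sum>i\<in>UNIV. axis i (f x $ i)) absolutely_integrable_on S"
    using absolutely_integrable_linear[OF assms bounded_linear_axis]
    by (intro absolutely_integrable_sum) (simp_all add: o_def)
  moreover have "(\<Sum>i\<in>UNIV. axis i (f x $ i)) = f x" for x
    by (simp add: vec_eq_iff axis_def if_distrib cong: if_cong)
  ultimately show ?thesis by simp
qed

lemma absolutely_integrable_vec_nth:
  fixes f :: "'a::euclidean_space \<Rightarrow> complex^'n"
  assumes "f absolutely_integrable_on S"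
  shows "(\<lambda>x. f x $ i) absolutely_integrable_on S"
  using absolutely_integrable_linear[OF assms bounded_linear_vec_nth] by (simp add: o_def)

lemma absolutely_integrable_mult_continuous:
  fixes f g :: "real \<Rightarrow> complex"
  assumes "f absolutely_integrable_on {a..b}" "continuous_on {a..b} g"
  shows "(\<lambda>x. f x * g x) absolutely_integrable_on {a..b}"
proof -
  have "bounded (g ` {a..b})" using assms(2) compact_continuous_image compact_imp_bounded by blast
  moreover have "g \<in> borel_measurable (lebesgue_on {a..b})"
    using assms(2) by (intro continuous_imp_measurable_on_sets_lebesgue) auto
  moreover have "bilinear ((*) :: complex \<Rightarrow> complex \<Rightarrow> complex)"
    using bilinear_times by blast
  ultimately show ?thesis
    using absolutely_integrable_bounded_measurable_product[of "(*)" g "{a..b}" f] assms(1)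
    by (simp add: mult.commute)
qed

lemma norm_vec2_le: "norm (v :: complex^2) \<le> norm (v $ 1) + norm (v $ 2)"
proof -
  have "L2_set (\<lambda>i. norm (v $ i)) UNIV \<le> (\<Sum>i\<in>UNIV. norm (v $ i))" by (rule L2_set_le_sum) simp
  then show ?thesis unfolding norm_vec_def sum_2 .
qed

lemma W11_iff:
  "y \<in> W11 \<longleftrightarrow> (\<exists>g. g absolutely_integrable_on {0..pi} \<and> (\<forall>x\<in>{0..pi}. y x = y 0 + integral {0..x} g))"
proof
  assume "y \<in> W11"
  then have "\<forall>i. \<exists>g. g absolutely_integrable_on {0..pi} \<and> (\<forall>x\<in>{0..pi}. (g has_integral (y x $ i - y 0 $ i)) {0..x})"
    unfolding W11_def using abs_continuous_on_indefinite_integral[of 0 pi] by auto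
  then obtain g where g: "\<And>i. g i absolutely_integrable_on {0..pi}"
    "\<And>i x. x \<in> {0..pi} \<Longrightarrow> (g i has_integral (y x $ i - y 0 $ i)) {0..x}" by metis
  define G where "G t = (\<chi> i. g i t)" for t
  have G: "G absolutely_integrable_on {0..pi}"
    using g(1) by (intro absolutely_integrable_vec) (simp add: G_def)
  have "y x = y 0 + integral {0..x} G" if x: "x \<in> {0..pi}" for x
  proof -
    have "G integrable_on {0..x}"
      using set_lebesgue_integral_eq_integral(1)[OF G] x by (auto intro: integrable_on_subinterval)
    from integral_linear[OF this bounded_linear_vec_nth]
    have "integral {0..x} (g i) = integral {0..x} G $ i" for i by (simp add: o_def G_def)
    moreover have "integral {0..x} (g i) = y x $ i - y 0 $ i" for i using integral_unique[OF g(2)[OF x]] .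
    ultimately have "y x $ i = y 0 $ i + integral {0..x} G $ i" for i by (metis add.commute diff_add_cancel)
    then show ?thesis by (simp add: vec_eq_iff)
  qed
  then show "\<exists>g. g absolutely_integrable_on {0..pi} \<and> (\<forall>x\<in>{0..pi}. y x = y 0 + integral {0..x} g)"
    using G by blast
next
  assume "\<exists>g. g absolutely_integrable_on {0..pi} \<and> (\<forall>x\<in>{0..pi}. y x = y 0 + integral {0..x} g)"
  then obtain g where g: "g absolutely_integrable_on {0..pi}"
    "\<And>x. x \<in> {0..pi} \<Longrightarrow> y x = y 0 + integral {0..x} g" by blast
  have "abs_continuous_on 0 pi (\<lambda>x. y x $ i)" for i
  proof (rule indefinite_integral_abs_continuous_on[OF absolutely_integrable_vec_nth[OF g(1)]])
    fix x :: real assume x: "x \<in> {0..pi}"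
    have "g integrable_on {0..x}"
      using set_lebesgue_integral_eq_integral(1)[OF g(1)] x by (auto intro: integrable_on_subinterval)
    from integral_linear[OF this bounded_linear_vec_nth]
    have "integral {0..x} (\<lambda>t. g t $ i) = integral {0..x} g $ i" by (simp add: o_def)
    then show "y x $ i = y 0 $ i + integral {0..x} (\<lambda>t. g t $ i)"
      using arg_cong[OF g(2)[OF x], of "\<lambda>v. v $ i"] by simp
  qed
  then show "y \<in> W11" by (simp add: W11_def)
qed

text \<open>The link between the pointwise derivative in \<open>Lop\<close> and the density of an
  absolutely continuous function.\<close>

lemma vector_derivative_AE:
  fixes y g :: "real \<Rightarrow> complex^2"
  assumes g: "g absolutely_integrable_on {0..pi}"
    and y: "\<And>x. x \<in> {0..pi} \<Longrightarrow> y x = y 0 + integral {0..x} g"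
  shows "AE x in Leb. vector_derivative y (at x within {0..pi}) = g x"
proof -
  have "AE x in Leb. x \<in> {0..pi}" by (rule AE_I2) simp
  with indefinite_integral_has_vector_derivative_AE[OF set_lebesgue_integral_eq_integral(1)[OF g]]
  show ?thesis
  proof eventually_elim
    case (elim x)
    have "((\<lambda>x. y 0 + integral {0..x} g) has_vector_derivative g x) (at x within {0..pi})"
      using elim(1) by (auto intro!: derivative_eq_intros)
    then have "(y has_vector_derivative g x) (at x within {0..pi})"
      by (rule has_vector_derivative_transform[rotated 2]) (use elim(2) in blast, rule y)
    then show ?case
      using elim(2) vector_derivative_within_cbox[of 0 pi x y "g x"] by simp
  qed
qed

section \<open>Square-integrable functions and comparison of norms\<close>

text \<open>Completeness of Lebesgue measure. It is needed because \<open>Lop p q y\<close> is known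
  only up to a null set.\<close>

lemma measurable_lebesgue_on_AE:
  fixes f g :: "'a::euclidean_space \<Rightarrow> 'b::euclidean_space"
  assumes "f \<in> borel_measurable (lebesgue_on S)" "S \<in> sets lebesgue" "AE x in lebesgue_on S. f x = g x"
  shows "g \<in> borel_measurable (lebesgue_on S)"
proof -
  have "(\<lambda>x. indicator S x *\<^sub>R f x) \<in> borel_measurable lebesgue"
    using assms by (simp add: borel_measurable_restrict_space_iff)
  moreover have "AE x in lebesgue. x \<in> S \<longrightarrow> f x = g x"
    using assms by (simp add: AE_restrict_space_iff)
  then have "AE x in lebesgue. indicator S x *\<^sub>R f x = indicator S x *\<^sub>R g x"
    by eventually_elim (auto simp: indicator_def)
  ultimately have "(\<lambda>x. indicator S x *\<^sub>R g x) \<in> borel_measurable lebesgue"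
    by (rule borel_measurable_AE)
  then show ?thesis using assms by (simp add: borel_measurable_restrict_space_iff)
qed

lemma L2_AE:
  assumes "f \<in> L2" "AE x in Leb. f x = g x"
  shows "g \<in> L2"
proof -
  have g: "g \<in> borel_measurable Leb"
    by (rule measurable_lebesgue_on_AE[OF _ _ assms(2)]) (use assms(1) in \<open>simp_all add: L2_def\<close>)
  moreover have "integrable Leb (\<lambda>x. (norm (g x))\<^sup>2)"
  proof (rule integrable_cong_AE_imp)
    show "integrable Leb (\<lambda>x. (norm (f x))\<^sup>2)" using assms(1) by (simp add: L2_def)
    show "AE x in Leb. (norm (f x))\<^sup>2 = (norm (g x))\<^sup>2" using assms(2) by eventually_elim simp
  qed (use g in measurable)
  ultimately show ?thesis by (simp add: L2_def)
qed

lemma L2_continuous_on: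
  assumes "continuous_on {0..pi} f"
  shows "f \<in> L2"
proof -
  have "f \<in> borel_measurable Leb"
    using assms by (intro continuous_imp_measurable_on_sets_lebesgue) auto
  moreover have "(\<lambda>x. (norm (f x))\<^sup>2) absolutely_integrable_on {0..pi}"
    using assms by (intro absolutely_integrable_continuous_real continuous_intros)
  ultimately show ?thesis by (simp add: L2_def absolutely_integrable_on_iff_integrable)
qed

lemma L2_add_mult:
  assumes f: "f \<in> L2" and g: "g \<in> L2"
  shows "(\<lambda>x. f x + c * g x) \<in> L2"
proof -
  have m: "f \<in> borel_measurable Leb" "g \<in> borel_measurable Leb" using f g by (auto simp: L2_def)
  have "integrable Leb (\<lambda>x. (norm (f x + c * g x))\<^sup>2)"
  proof (rule Bochner_Integration.integrable_bound)
    show "integrable Leb (\<lambda>x. 2 * (norm (f x))\<^sup>2 + 2 * (norm c)\<^sup>2 * (norm (g x))\<^sup>2)"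
      using f g by (auto simp: L2_def)
    have "(norm (f x + c * g x))\<^sup>2 \<le> 2 * (norm (f x))\<^sup>2 + 2 * (norm c)\<^sup>2 * (norm (g x))\<^sup>2" for x
    proof -
      have "(norm (f x + c * g x))\<^sup>2 \<le> (norm (f x) + norm c * norm (g x))\<^sup>2"
        using norm_triangle_ineq[of "f x" "c * g x"] by (intro power_mono) (auto simp: norm_mult)
      also have "\<dots> \<le> 2 * (norm (f x))\<^sup>2 + 2 * (norm c * norm (g x))\<^sup>2"
        using sum_squares_bound[of "norm (f x)" "norm c * norm (g x)"] by (simp add: power2_sum)
      finally show ?thesis by (simp add: power_mult_distrib)
    qed
    then show "AE x in Leb. norm ((norm (f x + c * g x))\<^sup>2) \<le> norm (2 * (norm (f x))\<^sup>2 + 2 * (norm c)\<^sup>2 * (norm (g x))\<^sup>2)"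
      by (intro AE_I2) (simp add: order_trans)
  qed (use m in measurable)
  then show ?thesis using m by (simp add: L2_def)
qed

lemma measure_Leb: "measure Leb {0..pi} = pi"
  by (simp add: measure_restrict_space)

lemma finite_measure_Leb: "finite_measure Leb"
  by (rule finite_measureI) (simp add: emeasure_restrict_space)

text \<open>The second part is the Cauchy-Schwarz inequality against the constant 1 on an interval
  of length \<pi>.\<close>

lemma L2_integrable_norm:
  assumes "f \<in> L2"
  shows "f absolutely_integrable_on {0..pi}"
    "(LINT x|Leb. norm (f x))\<^sup>2 \<le> pi * (LINT x|Leb. (norm (f x))\<^sup>2)"
proof -
  interpret finite_measure Leb by (rule finite_measure_Leb)
  have f: "f \<in> borel_measurable Leb" "integrable Leb (\<lambda>x. (norm (f x))\<^sup>2)" using assms by (auto simp: L2_def)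
  have "integrable Leb f"
  proof (rule Bochner_Integration.integrable_bound[of _ "\<lambda>x. 1 + (norm (f x))\<^sup>2"])
    have "r \<le> 1 + r\<^sup>2" for r :: real using sum_squares_bound[of r 1] zero_le_power2[of r] by (simp; linarith)
    then show "AE x in Leb. norm (f x) \<le> norm (1 + (norm (f x))\<^sup>2)" by (intro AE_I2) (simp add: abs_of_nonneg)
  qed (use f in auto)
  then show "f absolutely_integrable_on {0..pi}" by (simp add: absolutely_integrable_on_iff_integrable)
  have nf: "integrable Leb (\<lambda>x. norm (f x))" using \<open>integrable Leb f\<close> by (rule integrable_norm)
  \<comment> \<open>The mean value of the norm: nonnegativity of the variance around it is the
    desired inequality.\<close>
  define a where "a = (LINT x|Leb. norm (f x)) / pi"
  have "0 \<le> (LINT x|Leb. (norm (f x) - a)\<^sup>2)" by (intro Bochner_Integration.integral_nonneg) simp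
  also have "(\<lambda>x. (norm (f x) - a)\<^sup>2) = (\<lambda>x. (norm (f x))\<^sup>2 - 2 * a * norm (f x) + a\<^sup>2)"
    by (auto simp: power2_eq_square algebra_simps)
  also have "(LINT x|Leb. (norm (f x))\<^sup>2 - 2 * a * norm (f x) + a\<^sup>2)
      = (LINT x|Leb. (norm (f x))\<^sup>2) - 2 * a * (LINT x|Leb. norm (f x)) + pi * a\<^sup>2"
    using f(2) nf measure_Leb by simp
  also have "(LINT x|Leb. norm (f x)) = a * pi" by (simp add: a_def)
  finally have "pi * (pi * a\<^sup>2) \<le> pi * (LINT x|Leb. (norm (f x))\<^sup>2)"
    by (intro mult_left_mono) (auto simp: power2_eq_square algebra_simps)
  then show "(LINT x|Leb. norm (f x))\<^sup>2 \<le> pi * (LINT x|Leb. (norm (f x))\<^sup>2)"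
    by (simp add: a_def power2_eq_square)
qed

text \<open>Membership in \<open>H\<close> provides the integrable right-hand side of the integral
  equation. In the constant, \<open>sqrt pi\<close> is Cauchy-Schwarz for one component and 2 counts
  the components.\<close>

lemma H_absolutely_integrable:
  assumes "f \<in> H"
  shows "f absolutely_integrable_on {0..pi}"
    "integral {0..pi} (\<lambda>x. norm (f x)) \<le> 2 * sqrt pi * norm_H f"
proof -
  have L2: "(\<lambda>x. f x $ i) \<in> L2" for i using assms by (simp add: H_def)
  show f: "f absolutely_integrable_on {0..pi}"
    using L2_integrable_norm(1)[OF L2] by (rule absolutely_integrable_vec)
  have i: "integrable Leb (\<lambda>x. norm (f x $ i))" for i
    using L2_integrable_norm(1)[OF L2[of i]] by (simp add: absolutely_integrable_on_iff_integrable)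
  have n: "integrable Leb (\<lambda>x. norm (f x))"
    using f by (simp add: absolutely_integrable_on_iff_integrable)
  have le: "(LINT x|Leb. norm (f x $ i)) \<le> sqrt pi * norm_H f" for i
  proof -
    have "(LINT x|Leb. (norm (f x $ i))\<^sup>2) \<le> (\<Sum>i\<in>UNIV. LINT x|Leb. (norm (f x $ i))\<^sup>2)"
      by (rule member_le_sum) auto
    then have "(LINT x|Leb. norm (f x $ i))\<^sup>2 \<le> pi * (\<Sum>i\<in>UNIV. LINT x|Leb. (norm (f x $ i))\<^sup>2)"
      using L2_integrable_norm(2)[OF L2[of i]] by (meson mult_left_mono order_trans pi_ge_zero)
    then show ?thesis
      unfolding norm_H_def real_sqrt_mult[symmetric] by (rule real_le_rsqrt)
  qed
  have "integral {0..pi} (\<lambda>x. norm (f x)) = (LINT x|Leb. norm (f x))"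
    using n by (simp add: lebesgue_integral_eq_integral)
  also have "\<dots> \<le> (LINT x|Leb. norm (f x $ 1) + norm (f x $ 2))"
    using n i norm_vec2_le by (intro integral_mono) auto
  also have "\<dots> = (LINT x|Leb. norm (f x $ 1)) + (LINT x|Leb. norm (f x $ 2))"
    using i by (intro Bochner_Integration.integral_add) auto
  also have "\<dots> \<le> 2 * sqrt pi * norm_H f" using le[of 1] le[of 2] by simp
  finally show "integral {0..pi} (\<lambda>x. norm (f x)) \<le> 2 * sqrt pi * norm_H f" .
qed

lemma norm_H_le:
  assumes y: "continuous_on {0..pi} y" and "0 \<le> D" and D: "\<And>x. x \<in> {0..pi} \<Longrightarrow> norm (y x) \<le> D"
  shows "norm_H y \<le> sqrt (2 * pi) * D"
proof -
  interpret finite_measure Leb by (rule finite_measure_Leb)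
  have "(LINT x|Leb. (norm (y x $ i))\<^sup>2) \<le> pi * D\<^sup>2" for i
  proof -
    have "(\<lambda>x. y x $ i) \<in> L2" by (rule L2_continuous_on) (intro continuous_intros y)
    then have "(LINT x|Leb. (norm (y x $ i))\<^sup>2) \<le> (LINT x|Leb. D\<^sup>2)"
      using D order_trans[OF Finite_Cartesian_Product.norm_nth_le]
      by (intro integral_mono power_mono) (auto simp: L2_def)
    then show ?thesis using measure_Leb by simp
  qed
  from this[of 1] this[of 2] have "(\<Sum>i\<in>UNIV. LINT x|Leb. (norm (y x $ i))\<^sup>2) \<le> 2 * pi * D\<^sup>2"
    by (simp add: sum_2)
  then have "norm_H y \<le> sqrt (2 * pi * D\<^sup>2)" unfolding norm_H_def by (rule real_sqrt_le_mono)
  then show ?thesis using \<open>0 \<le> D\<close> by (simp add: real_sqrt_mult)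
qed

lemma H_AE:
  assumes "f \<in> H" "AE x in Leb. f x = g x"
  shows "g \<in> H"
proof -
  have "AE x in Leb. f x $ i = g x $ i" for i using assms(2) by eventually_elim simp
  moreover have "(\<lambda>x. f x $ i) \<in> L2" for i using assms(1) by (simp add: H_def)
  ultimately have "(\<lambda>x. g x $ i) \<in> L2" for i by (rule L2_AE[rotated])
  then show ?thesis by (simp add: H_def)
qed

lemma H_add_smult: "f \<in> H \<Longrightarrow> g \<in> H \<Longrightarrow> (\<lambda>x. f x + c *s g x) \<in> H"
  using L2_add_mult[of "\<lambda>x. f x $ i" "\<lambda>x. g x $ i" c for i] by (simp add: H_def)

lemma H_continuous_on: "continuous_on {0..pi} f \<Longrightarrow> f \<in> H"
  unfolding H_def by (auto intro!: L2_continuous_on continuous_intros)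

section \<open>The Dirac system\<close>

text \<open>Since \<open>B ** B = - mat 1\<close>, the equation \<open>B y' + V y - \<lambda> y = f\<close> is \<open>y' = rhs p q \<lambda> f x y\<close>.\<close>

definition rhs :: "(real \<Rightarrow> complex) \<Rightarrow> (real \<Rightarrow> complex) \<Rightarrow> complex \<Rightarrow> (real \<Rightarrow> complex^2) \<Rightarrow> real \<Rightarrow> complex^2 \<Rightarrow> complex^2"
  where "rhs p q lam f s u = B *v (V p q s *v u - lam *s u - f s)"

text \<open>The integral form of the equation. Continuity is part of it because it makes the
  integrand integrable when \<open>p\<close>, \<open>q\<close> and \<open>f\<close> are.\<close>

definition solution :: "(real \<Rightarrow> complex) \<Rightarrow> (real \<Rightarrow> complex) \<Rightarrow> complex \<Rightarrow> (real \<Rightarrow> complex^2) \<Rightarrow> (real \<Rightarrow> complex^2) \<Rightarrow> bool"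
  where "solution p q lam f y \<longleftrightarrow> continuous_on {0..pi} y \<and>
    (\<forall>x\<in>{0..pi}. y x = y 0 + integral {0..x} (\<lambda>s. rhs p q lam f s (y s)))"

definition swap :: "complex^2 \<Rightarrow> complex^2"
  where "swap u = vector [u $ 2, u $ 1]"

lemma swap_nth [simp]: "swap u $ 1 = u $ 2" "swap u $ 2 = u $ 1"
  by (simp_all add: swap_def)

lemma vec2_eqI: "u $ 1 = v $ 1 \<Longrightarrow> u $ 2 = v $ 2 \<Longrightarrow> u = (v :: 'a^2)"
  by (simp add: vec_eq_iff forall_2)

lemma B_nth [simp]: "(B *v u) $ 1 = u $ 2" "(B *v u) $ 2 = - (u $ 1)"
  by (simp_all add: B_def matrix_vector_mult_def sum_2)

lemma V_nth [simp]:
  "(V p q s *v u) $ 1 = p s * u $ 1 + q s * u $ 2"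
  "(V p q s *v u) $ 2 = q s * u $ 1 - p s * u $ 2"
  by (simp_all add: V_def matrix_vector_mult_def sum_2)

lemma rhs_nth:
  "rhs p q lam f s u $ 1 = q s * u $ 1 - p s * u $ 2 - lam * u $ 2 - f s $ 2"
  "rhs p q lam f s u $ 2 = lam * u $ 1 + f s $ 1 - p s * u $ 1 - q s * u $ 2"
  by (simp_all add: rhs_def)

lemma rhs_iff: "w = rhs p q lam f s u \<longleftrightarrow> B *v w + V p q s *v u - lam *s u = f s"
  by (auto simp: vec_eq_iff forall_2 rhs_nth algebra_simps)

lemma rhs_linear:
  "rhs p q lam (\<lambda>x. a *s f x + b *s g x) s (a *s u + b *s v) = a *s rhs p q lam f s u + b *s rhs p q lam g s v"
  by (rule vec2_eqI) (simp_all add: rhs_nth algebra_simps)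

text \<open>With S the matrix of \<open>swap\<close>, S B S = -B, and S V(x) S is V with p replaced
  by -p, that is V(\<pi> - x) under the symmetry. The sign of B matches the sign from
  differentiating along \<pi> - x.\<close>

lemma rhs_reflect:
  assumes "p (pi - s) = - p s" "q (pi - s) = q s"
  shows "rhs p q lam (\<lambda>x. swap (f (pi - x))) s (swap u) = - swap (rhs p q lam f (pi - s) u)"
  by (rule vec2_eqI) (simp_all add: rhs_nth assms algebra_simps)

text \<open>The factor 2 comes from adding the bounds of the two components. As \<open>rhs\<close>
  is affine in \<open>u\<close>, the Lipschitz bound is the growth bound with zero right-hand side
  at \<open>u - v\<close>.\<close>

lemma norm_rhs_le:
  "norm (rhs p q lam f s u - rhs p q lam f s v) \<le> 2 * (norm (p s) + norm (q s) + norm lam) * norm (u - v)"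
  "norm (rhs p q lam f s u) \<le> 2 * (norm (p s) + norm (q s) + norm lam) * norm u + 2 * norm (f s)"
proof -
  have *: "norm (rhs p q lam g s w) \<le> 2 * (norm (p s) + norm (q s) + norm lam) * norm w + 2 * norm (g s)"
    for g :: "real \<Rightarrow> complex^2" and w
  proof -
    have c: "norm (c * w $ i) \<le> norm c * norm w" for c i
      unfolding norm_mult by (intro mult_left_mono Finite_Cartesian_Product.norm_nth_le) auto
    have g: "norm (g s $ i) \<le> norm (g s)" for i by (rule Finite_Cartesian_Product.norm_nth_le)
    have "norm (rhs p q lam g s w $ 1) \<le> norm (q s * w $ 1) + norm (p s * w $ 2) + norm (lam * w $ 2) + norm (g s $ 2)"
      unfolding rhs_nth by norm
    moreover have "norm (rhs p q lam g s w $ 2) \<le> norm (lam * w $ 1) + norm (g s $ 1) + norm (p s * w $ 1) + norm (q s * w $ 2)"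
      unfolding rhs_nth by norm
    ultimately show ?thesis
      using norm_vec2_le[of "rhs p q lam g s w"] c[of "q s" 1] c[of "p s" 2] c[of lam 2] g[of 2]
        c[of lam 1] g[of 1] c[of "p s" 1] c[of "q s" 2]
      by (simp add: distrib_right distrib_left)
  qed
  show "norm (rhs p q lam f s u) \<le> 2 * (norm (p s) + norm (q s) + norm lam) * norm u + 2 * norm (f s)" by (rule *)
  have "rhs p q lam f s u - rhs p q lam f s v = rhs p q lam (\<lambda>_. 0) s (u - v)"
    by (rule vec2_eqI) (simp_all add: rhs_nth algebra_simps)
  then show "norm (rhs p q lam f s u - rhs p q lam f s v) \<le> 2 * (norm (p s) + norm (q s) + norm lam) * norm (u - v)"
    using *[of "\<lambda>_. 0" "u - v"] by simp
qed

lemma bounded_linear_swap: "bounded_linear swap"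
proof -
  have "linear swap" by (rule linearI) (auto intro!: vec2_eqI)
  then show ?thesis by (simp add: linear_conv_bounded_linear)
qed

lemma bounded_linear_smult: "bounded_linear (\<lambda>u :: complex^2. c *s u)"
proof -
  have "linear (\<lambda>u :: complex^2. c *s u)" by (rule linearI) (auto intro!: vec2_eqI simp: algebra_simps)
  then show ?thesis by (simp add: linear_conv_bounded_linear)
qed

lemma norm_swap [simp]: "norm (swap u) = norm u"
  by (simp add: norm_vec_def L2_set_def sum_2 add.commute)

lemma norm_smult: "norm (c *s u) = norm c * norm (u :: complex^2)"
  by (simp add: norm_vec_def L2_set_def sum_2 norm_mult power_mult_distrib real_sqrt_mult flip: distrib_left)

lemma rhs_absolutely_integrable:
  assumes "p \<in> L1" "q \<in> L1" and f: "f absolutely_integrable_on {0..pi}" and y: "continuous_on {0..pi} y"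
  shows "(\<lambda>s. rhs p q lam f s (y s)) absolutely_integrable_on {0..pi}"
proof (rule absolutely_integrable_vec)
  have p: "p absolutely_integrable_on {0..pi}" and q: "q absolutely_integrable_on {0..pi}"
    using assms by (auto simp: L1_iff)
  have yi: "continuous_on {0..pi} (\<lambda>s. y s $ i)" for i by (intro continuous_intros y)
  have l: "(\<lambda>s. lam * y s $ i) absolutely_integrable_on {0..pi}" for i
    by (intro absolutely_integrable_continuous_real continuous_intros yi)
  note * = absolutely_integrable_mult_continuous[OF p yi] absolutely_integrable_mult_continuous[OF q yi]
    absolutely_integrable_vec_nth[OF f] l
  fix i :: 2
  show "(\<lambda>s. rhs p q lam f s (y s) $ i) absolutely_integrable_on {0..pi}"
    using exhaust_2[of i] by (auto simp: rhs_nth intro!: set_integral_diff(1) set_integral_add(1) *)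
qed

lemma solution_linear:
  assumes pq: "p \<in> L1" "q \<in> L1"
    and f: "f absolutely_integrable_on {0..pi}" "g absolutely_integrable_on {0..pi}"
    and y: "solution p q lam f y" and z: "solution p q lam g z"
  shows "solution p q lam (\<lambda>x. a *s f x + b *s g x) (\<lambda>x. a *s y x + b *s z x)"
  unfolding solution_def
proof (intro conjI ballI)
  have cont: "continuous_on {0..pi} y" "continuous_on {0..pi} z" using y z by (auto simp: solution_def)
  then show "continuous_on {0..pi} (\<lambda>x. a *s y x + b *s z x)"
    by (intro continuous_intros bounded_linear.continuous_on[OF bounded_linear_smult])
  fix x assume x: "x \<in> {0..pi}"
  have sub: "{0..x} \<subseteq> {0..pi}" using x by auto
  have i: "(\<lambda>s. rhs p q lam f s (y s)) integrable_on {0..x}" "(\<lambda>s. rhs p q lam g s (z s)) integrable_on {0..x}"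
    using integrable_on_subinterval[OF set_lebesgue_integral_eq_integral(1)[OF rhs_absolutely_integrable[OF pq f(1) cont(1)]] sub]
      integrable_on_subinterval[OF set_lebesgue_integral_eq_integral(1)[OF rhs_absolutely_integrable[OF pq f(2) cont(2)]] sub] .
  note lin = integral_linear[OF i(1) bounded_linear_smult[of a]] integral_linear[OF i(2) bounded_linear_smult[of b]]
  have "integral {0..x} (\<lambda>s. rhs p q lam (\<lambda>x. a *s f x + b *s g x) s (a *s y s + b *s z s))
      = integral {0..x} (\<lambda>s. a *s rhs p q lam f s (y s)) + integral {0..x} (\<lambda>s. b *s rhs p q lam g s (z s))"
    unfolding rhs_linear
    using integrable_linear[OF i(1) bounded_linear_smult[of a]] integrable_linear[OF i(2) bounded_linear_smult[of b]]
    by (intro Henstock_Kurzweil_Integration.integral_add) (simp_all add: o_def)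
  also have "\<dots> = a *s integral {0..x} (\<lambda>s. rhs p q lam f s (y s)) + b *s integral {0..x} (\<lambda>s. rhs p q lam g s (z s))"
    using lin by (simp add: o_def)
  also have "\<dots> = a *s (y x - y 0) + b *s (z x - z 0)"
  proof -
    have "integral {0..x} (\<lambda>s. rhs p q lam f s (y s)) = y x - y 0" "integral {0..x} (\<lambda>s. rhs p q lam g s (z s)) = z x - z 0"
      using y z x unfolding solution_def by (metis add_diff_cancel_left')+
    then show ?thesis by simp
  qed
  finally show "a *s y x + b *s z x = a *s y 0 + b *s z 0 +
      integral {0..x} (\<lambda>s. rhs p q lam (\<lambda>x. a *s f x + b *s g x) s (a *s y s + b *s z s))"
    by (auto intro!: vec2_eqI simp: algebra_simps)
qed

lemma has_integral_reflect_pi: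
  fixes h :: "real \<Rightarrow> 'b::real_normed_vector"
  assumes "(h has_integral i) {pi - x..pi}"
  shows "((\<lambda>s. h (pi - s)) has_integral i) {0..x}"
proof (cases "0 \<le> x")
  case True
  have img: "(\<lambda>s. pi - s) ` {pi - x..pi} = {0..x}"
  proof (intro equalityI subsetI)
    fix t assume "t \<in> {0..x}"
    then show "t \<in> (\<lambda>s. pi - s) ` {pi - x..pi}" by (intro image_eqI[of _ _ "pi - t"]) auto
  qed auto
  have "((\<lambda>s. h ((-1) *\<^sub>R s + pi)) has_integral (1 / (\<bar>-1\<bar> ^ DIM(real))) *\<^sub>R i)
      ((\<lambda>x. (1 / (-1)) *\<^sub>R x + -((1 / (-1)) *\<^sub>R pi)) ` cbox (pi - x) pi)"
    by (rule has_integral_affinity) (use assms in auto)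
  then show ?thesis using img by (simp add: add.commute[of "- _" pi])
next
  case False
  then show ?thesis using assms by simp
qed

text \<open>The minus sign in \<open>rhs_reflect\<close> undoes the reversal of orientation. The
  symmetry holds only almost everywhere, which the integral equation does not notice.\<close>

lemma solution_reflect:
  assumes pq: "p \<in> L1" "q \<in> L1" and f: "f absolutely_integrable_on {0..pi}"
    and sym: "AE x in Leb. p (pi - x) = - p x" "AE x in Leb. q (pi - x) = q x"
    and y: "solution p q lam f y"
  shows "solution p q lam (\<lambda>x. swap (f (pi - x))) (\<lambda>x. swap (y (pi - x)))"
  unfolding solution_def
proof (intro conjI ballI)
  have cont: "continuous_on {0..pi} y" using y by (auto simp: solution_def)
  have "continuous_on {0..pi} (\<lambda>x. y (pi - x))"
    by (rule continuous_on_compose2[OF cont]) (auto intro!: continuous_intros)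
  then show "continuous_on {0..pi} (\<lambda>x. swap (y (pi - x)))"
    by (rule bounded_linear.continuous_on[OF bounded_linear_swap])
  have "AE x in Leb. p (pi - x) = - p x \<and> q (pi - x) = q x"
    using sym by eventually_elim simp
  then obtain Z where Z: "negligible Z" "\<And>x. x \<in> {0..pi} - Z \<Longrightarrow> p (pi - x) = - p x \<and> q (pi - x) = q x"
    by (rule AE_lebesgue_onE) auto
  fix x :: real assume x: "x \<in> {0..pi}"
  let ?r = "\<lambda>s. rhs p q lam f s (y s)"
  have ri: "?r integrable_on {0..pi}"
    by (rule set_lebesgue_integral_eq_integral(1)[OF rhs_absolutely_integrable[OF pq f cont]])
  have r: "integral {0..t} ?r = y t - y 0" if "t \<in> {0..pi}" for t
    using y that unfolding solution_def by (metis add_diff_cancel_left')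
  \<comment> \<open>The integral equation starts at 0 and reflection moves its starting point to
    \<pi>; the increment of \<open>y\<close> over [\<pi> - x, \<pi>] is therefore expressed
    first.\<close>
  have "integral {0..pi - x} ?r + integral {pi - x..pi} ?r = integral {0..pi} ?r"
    using ri x by (intro Henstock_Kurzweil_Integration.integral_combine) auto
  then have "integral {pi - x..pi} ?r = integral {0..pi} ?r - integral {0..pi - x} ?r"
    by (metis add_diff_cancel_left')
  also have "\<dots> = y pi - y (pi - x)"
    using r[of "pi - x"] r[of pi] x by simp
  finally have "integral {pi - x..pi} ?r = y pi - y (pi - x)" .
  moreover have "?r integrable_on {pi - x..pi}"
    using ri x by (auto intro: integrable_on_subinterval)
  ultimately have "(?r has_integral (y pi - y (pi - x))) {pi - x..pi}" by (metis integrable_integral)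
  then have "((\<lambda>s. ?r (pi - s)) has_integral (y pi - y (pi - x))) {0..x}" by (rule has_integral_reflect_pi)
  from has_integral_neg[OF has_integral_linear[OF this bounded_linear_swap]]
  have "((\<lambda>s. - swap (?r (pi - s))) has_integral (- swap (y pi - y (pi - x)))) {0..x}" by (simp add: o_def)
  then have "((\<lambda>s. rhs p q lam (\<lambda>x. swap (f (pi - x))) s (swap (y (pi - s)))) has_integral (- swap (y pi - y (pi - x)))) {0..x}"
    by (rule has_integral_spike[OF Z(1), rotated]) (use Z(2) x in \<open>auto intro!: rhs_reflect\<close>)
  from integral_unique[OF this]
  show "swap (y (pi - x)) = swap (y (pi - 0)) + integral {0..x} (\<lambda>s. rhs p q lam (\<lambda>x. swap (f (pi - x))) s (swap (y (pi - s))))"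
    by (auto intro!: vec2_eqI)
qed

lemma absolutely_integrable_swap_reflect:
  assumes "f absolutely_integrable_on {0..pi}"
  shows "(\<lambda>x. swap (f (pi - x))) absolutely_integrable_on {0..pi}"
    "integral {0..pi} (\<lambda>x. norm (swap (f (pi - x)))) = integral {0..pi} (\<lambda>x. norm (f x))"
proof -
  have fi: "f integrable_on {0..pi}" "(\<lambda>x. norm (f x)) integrable_on {0..pi}"
    using assms by (auto simp: absolutely_integrable_on_def)
  have 1: "((\<lambda>x. f (pi - x)) has_integral (integral {0..pi} f)) {0..pi}"
    using has_integral_reflect_pi[of f _ pi] fi(1) integrable_integral by auto
  have 2: "((\<lambda>x. norm (f (pi - x))) has_integral (integral {0..pi} (\<lambda>x. norm (f x)))) {0..pi}"
    using has_integral_reflect_pi[of "\<lambda>x. norm (f x)" _ pi] fi(2) integrable_integral by auto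
  have "(\<lambda>x. f (pi - x)) absolutely_integrable_on {0..pi}"
    using 1 2 unfolding absolutely_integrable_on_def by (auto intro: has_integral_integrable)
  from absolutely_integrable_linear[OF this bounded_linear_swap]
  show "(\<lambda>x. swap (f (pi - x))) absolutely_integrable_on {0..pi}" by (simp add: o_def)
  show "integral {0..pi} (\<lambda>x. norm (swap (f (pi - x)))) = integral {0..pi} (\<lambda>x. norm (f x))"
    using integral_unique[OF 2] by simp
qed

lemma bound_absolutely_integrable:
  assumes "p \<in> L1" "q \<in> L1"
  shows "(\<lambda>s. 2 * (norm (p s) + norm (q s) + norm lam)) absolutely_integrable_on {0..pi}"
proof -
  have "(\<lambda>s. norm (p s)) absolutely_integrable_on {0..pi}" "(\<lambda>s. norm (q s)) absolutely_integrable_on {0..pi}"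
    using assms absolutely_integrable_norm[unfolded o_def] by (auto simp: L1_iff)
  moreover have "(\<lambda>s. norm lam) absolutely_integrable_on {0..pi}"
    by (intro absolutely_integrable_continuous_real continuous_intros)
  ultimately show ?thesis by (intro set_integrable_mult_right set_integral_add(1)) auto
qed

text \<open>The initial point is free: 0 serves surjectivity, the midpoint serves the
  eigenfunctions.\<close>

lemma solution_exists:
  assumes pq: "p \<in> L1" "q \<in> L1" and f: "f absolutely_integrable_on {0..pi}" and x0: "x0 \<in> {0..pi}"
  shows "\<exists>y. solution p q lam f y \<and> y x0 = v"
proof -
  have "\<exists>y. continuous_on {0..pi} y \<and> (\<forall>x\<in>{0..pi}. y x = v + integral {0..x} (\<lambda>s. rhs p q lam f s (y s))
       - integral {0..x0} (\<lambda>s. rhs p q lam f s (y s)))"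
  proof (rule caratheodory_exists[OF bound_absolutely_integrable[OF pq, of lam] _ _ _ x0])
    show "(\<lambda>s. rhs p q lam f s (y s)) integrable_on {0..pi}" if "continuous_on {0..pi} y" for y
      by (rule set_lebesgue_integral_eq_integral(1)[OF rhs_absolutely_integrable[OF pq f that]])
  qed (rule norm_rhs_le(1) | simp)+
  then obtain y where y: "continuous_on {0..pi} y"
    "\<And>x. x \<in> {0..pi} \<Longrightarrow> y x = v + integral {0..x} (\<lambda>s. rhs p q lam f s (y s))
       - integral {0..x0} (\<lambda>s. rhs p q lam f s (y s))" by blast
  have "y x = y 0 + integral {0..x} (\<lambda>s. rhs p q lam f s (y s))" if "x \<in> {0..pi}" for x
    using y(2)[OF that] y(2)[of 0] by simp
  then have "solution p q lam f y" using y(1) unfolding solution_def by blast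
  moreover have "y x0 = v" using y(2)[OF x0] by simp
  ultimately show ?thesis by blast
qed

text \<open>The point is uniformity: \<open>K\<close> is fixed before \<open>f\<close> and
  \<open>y\<close>, as a bounded inverse requires.\<close>

lemma solution_bound:
  assumes pq: "p \<in> L1" "q \<in> L1"
  obtains K where "0 \<le> K" "\<And>f y x. \<lbrakk>f absolutely_integrable_on {0..pi}; solution p q lam f y; y 0 = 0; x \<in> {0..pi}\<rbrakk>
    \<Longrightarrow> norm (y x) \<le> K * integral {0..pi} (\<lambda>x. norm (f x))"
proof
  let ?m = "\<lambda>s. 2 * (norm (p s) + norm (q s) + norm lam)"
  note m = bound_absolutely_integrable[OF pq, of lam]
  \<comment> \<open>One factor 2 is from Gronwall's inequality, the other is the coefficient of
    \<open>norm (f s)\<close> in the growth bound of \<open>rhs\<close>.\<close>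
  let ?K = "4 * exp (2 * integral {0..pi} ?m)"
  show "0 \<le> ?K" by simp
  fix f y x assume f: "f absolutely_integrable_on {0..pi}" and y: "solution p q lam f y" "y 0 = 0" and x: "x \<in> {0..pi}"
  have cont: "continuous_on {0..pi} y" using y by (auto simp: solution_def)
  have nf: "(\<lambda>x. norm (f x)) integrable_on {0..pi}" using f by (simp add: absolutely_integrable_on_def)
  have my: "(\<lambda>s. ?m s * norm (y s)) integrable_on {0..pi}"
    using absolutely_integrable_continuous_mult[OF m continuous_on_norm[OF cont]]
    by (rule set_lebesgue_integral_eq_integral(1))
  have "norm (y x) \<le> 2 * (2 * integral {0..pi} (\<lambda>x. norm (f x))) * exp (2 * integral {0..pi} ?m)"
  proof (rule gronwall_integrable[OF m _ continuous_on_norm[OF cont] _ x])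
    show "0 \<le> 2 * integral {0..pi} (\<lambda>x. norm (f x))" using nf by (simp add: Henstock_Kurzweil_Integration.integral_nonneg)
    fix t :: real assume t: "t \<in> {0..pi}"
    have sub: "{0..t} \<subseteq> {0..pi}" using t by auto
    have "y t = integral {0..t} (\<lambda>s. rhs p q lam f s (y s))"
      using y t unfolding solution_def by auto
    also have "norm \<dots> \<le> integral {0..t} (\<lambda>s. ?m s * norm (y s) + 2 * norm (f s))"
    proof (rule integral_norm_bound_integral)
      show "(\<lambda>s. rhs p q lam f s (y s)) integrable_on {0..t}"
        using set_lebesgue_integral_eq_integral(1)[OF rhs_absolutely_integrable[OF pq f cont]] sub
        by (rule integrable_on_subinterval)
      show "(\<lambda>s. ?m s * norm (y s) + 2 * norm (f s)) integrable_on {0..t}"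
        using integrable_on_subinterval[OF my sub] integrable_on_subinterval[OF nf sub]
        by (intro Henstock_Kurzweil_Integration.integrable_add integrable_on_mult_right) auto
    qed (rule norm_rhs_le(2))
    also have "\<dots> = integral {0..t} (\<lambda>s. ?m s * norm (y s)) + integral {0..t} (\<lambda>s. 2 * norm (f s))"
      using integrable_on_subinterval[OF my sub] integrable_on_subinterval[OF nf sub]
      by (intro Henstock_Kurzweil_Integration.integral_add integrable_on_mult_right) auto
    also have "integral {0..t} (\<lambda>s. 2 * norm (f s)) \<le> 2 * integral {0..pi} (\<lambda>s. norm (f s))"
      using integral_subset_le[OF sub integrable_on_subinterval[OF nf sub] nf] by simp
    finally show "norm (y t) \<le> 2 * integral {0..pi} (\<lambda>s. norm (f s)) + integral {0..t} (\<lambda>s. ?m s * norm (y s))"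
      by simp
  qed auto
  then show "norm (y x) \<le> ?K * integral {0..pi} (\<lambda>x. norm (f x))" by (simp add: mult_ac)
qed

section \<open>Passage between the operator domain and the integral equation\<close>

lemma W11_continuous_on:
  assumes "y \<in> W11"
  shows "continuous_on {0..pi} y"
proof -
  have "continuous_on {0..pi} (\<lambda>x. \<chi> i. y x $ i)"
    using assms abs_continuous_on_imp_continuous_on unfolding W11_def
    by (intro continuous_on_vec_lambda) auto
  then show ?thesis by simp
qed

lemma W11_imp_solution:
  assumes y: "y \<in> W11" and L: "Lop p q y \<in> H"
  shows "(\<lambda>x. Lop p q y x - lam *s y x) \<in> H"
    "solution p q lam (\<lambda>x. Lop p q y x - lam *s y x) y"
proof -
  let ?f = "\<lambda>x. Lop p q y x - lam *s y x"
  have cont: "continuous_on {0..pi} y" by (rule W11_continuous_on[OF y])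
  show "?f \<in> H"
    using H_add_smult[OF L H_continuous_on[OF cont], of "- lam"] by (simp add: vector_smult_lneg)
  obtain g where g: "g absolutely_integrable_on {0..pi}"
    "\<And>x. x \<in> {0..pi} \<Longrightarrow> y x = y 0 + integral {0..x} g"
    using y unfolding W11_iff by blast
  have "AE x in Leb. vector_derivative y (at x within {0..pi}) = g x"
    by (rule vector_derivative_AE[OF g(1)]) (rule g(2))
  then have "AE x in Leb. g x = rhs p q lam ?f x (y x)"
  proof eventually_elim
    case (elim x)
    then have "Lop p q y x = B *v g x + V p q x *v y x" by (simp only: Lop_def)
    then show ?case unfolding rhs_iff by simp
  qed
  then obtain Z where Z: "negligible Z" "\<And>x. x \<in> {0..pi} - Z \<Longrightarrow> g x = rhs p q lam ?f x (y x)"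
    by (rule AE_lebesgue_onE) auto
  have "integral {0..x} g = integral {0..x} (\<lambda>s. rhs p q lam ?f s (y s))" if "x \<in> {0..pi}" for x
    by (rule integral_spike[OF Z(1)]) (use Z(2) that in auto)
  then show "solution p q lam ?f y"
    unfolding solution_def using cont g(2) by metis
qed

lemma solution_imp_W11:
  assumes pq: "p \<in> L1" "q \<in> L1" and f: "f \<in> H" and y: "solution p q lam f y"
  shows "y \<in> W11" "AE x in Leb. Lop p q y x - lam *s y x = f x" "Lop p q y \<in> H"
proof -
  have cont: "continuous_on {0..pi} y" using y by (simp add: solution_def)
  let ?g = "\<lambda>s. rhs p q lam f s (y s)"
  have g: "?g absolutely_integrable_on {0..pi}"
    by (rule rhs_absolutely_integrable[OF pq H_absolutely_integrable(1)[OF f] cont])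
  have yg: "y x = y 0 + integral {0..x} ?g" if "x \<in> {0..pi}" for x
    using y that unfolding solution_def by blast
  show "y \<in> W11" unfolding W11_iff using g yg by blast
  have "AE x in Leb. vector_derivative y (at x within {0..pi}) = ?g x"
    by (rule vector_derivative_AE[OF g]) (rule yg)
  then show AE: "AE x in Leb. Lop p q y x - lam *s y x = f x"
  proof eventually_elim
    case (elim x)
    then have "Lop p q y x = B *v ?g x + V p q x *v y x" by (simp only: Lop_def)
    moreover have "B *v ?g x + V p q x *v y x - lam *s y x = f x"
      by (rule rhs_iff[THEN iffD1]) (rule refl)
    ultimately show ?case by simp
  qed
  then have "AE x in Leb. f x + lam *s y x = Lop p q y x"
    by eventually_elim (simp add: algebra_simps)
  then show "Lop p q y \<in> H" by (rule H_AE[OF H_add_smult[OF f H_continuous_on[OF cont]]])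
qed

lemma norm_H_nonneg: "0 \<le> norm_H f"
  unfolding norm_H_def by (intro real_sqrt_ge_zero sum_nonneg Bochner_Integration.integral_nonneg) auto

text \<open>Injectivity in \<open>resolvent_set\<close> yields only equality almost everywhere,
  while the contradiction is drawn from the value at a single point.\<close>

lemma continuous_on_AE_eq_0:
  fixes u :: "real \<Rightarrow> 'b::real_normed_vector"
  assumes "continuous_on {a..b} u" "AE x in lebesgue_on {a..b}. u x = 0" "x \<in> {a<..<b}"
  shows "u x = 0"
proof (rule ccontr)
  assume "u x \<noteq> 0"
  obtain Z where Z: "negligible Z" "\<And>t. t \<in> {a..b} - Z \<Longrightarrow> u t = 0"
    using AE_lebesgue_onE[OF assms(2)] by auto
  have "continuous (at x) u"
    using assms(1,3) by (intro continuous_on_interior) auto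
  then have "\<forall>\<^sub>F t in at x. u t \<noteq> 0" using \<open>u x \<noteq> 0\<close> tendsto_imp_eventually_ne unfolding isCont_def by blast
  then obtain d where d: "d > 0" "\<And>t. t \<noteq> x \<Longrightarrow> dist t x < d \<Longrightarrow> u t \<noteq> 0"
    unfolding eventually_at by blast
  define e where "e = min d (b - x)"
  have e: "e > 0" using d assms(3) by (auto simp: e_def)
  have "{x<..<x + e} \<subseteq> Z"
  proof
    fix t assume t: "t \<in> {x<..<x + e}"
    then have "u t \<noteq> 0" by (intro d(2)) (auto simp: dist_real_def e_def)
    moreover have "t \<in> {a..b}" using t assms(3) by (auto simp: e_def)
    ultimately show "t \<in> Z" using Z(2) by blast
  qed
  then have "negligible {x<..<x + e}" using Z(1) negligible_subset by blast
  then show False using e negligible_interval(2)[of x "x + e"] by (simp add: box_real)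
qed

section \<open>The boundary matrix\<close>

lemma J_eq: "J A j k = A $ 1 $ j * A $ 2 $ k - A $ 1 $ k * A $ 2 $ j"
  by (simp add: J_def det_2)

text \<open>If \<open>j12\<close> is nonzero, Cramer's rule solves for y(0), and the conditions on
  the minors make the result a multiple of S y(\<pi>). Otherwise all minors except
  \<open>j34\<close> vanish, and the condition is y(\<pi>) = 0.\<close>

lemma boundary_condition:
  fixes A :: "complex^4^2"
  assumes ind: "\<And>c\<^sub>1 c\<^sub>2. c\<^sub>1 *s row 1 A + c\<^sub>2 *s row 2 A = 0 \<Longrightarrow> c\<^sub>1 = 0 \<and> c\<^sub>2 = 0"
    and J: "J A 1 4 = 0" "J A 2 3 = 0" "J A 1 3 + J A 2 4 = 0"
  obtains al be where "(al, be) \<noteq> (0, 0)"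
    "\<And>y. U A 1 y = 0 \<and> U A 2 y = 0 \<longleftrightarrow> al *s y 0 + be *s swap (y pi) = 0"
proof -
  define a b where "a = A $ 1" and "b = A $ 2"
  have U: "U A 1 y = a $ 1 * y 0 $ 1 + a $ 2 * y 0 $ 2 + a $ 3 * y pi $ 1 + a $ 4 * y pi $ 2"
    "U A 2 y = b $ 1 * y 0 $ 1 + b $ 2 * y 0 $ 2 + b $ 3 * y pi $ 1 + b $ 4 * y pi $ 2" for y
    by (simp_all add: U_def a_def b_def)
  have bc: "al *s y 0 + be *s swap (y pi) = 0 \<longleftrightarrow> al * y 0 $ 1 + be * y pi $ 2 = 0 \<and> al * y 0 $ 2 + be * y pi $ 1 = 0"
    for al be and y :: "real \<Rightarrow> complex^2"
    by (simp add: vec_eq_iff forall_2)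
  have j: "a $ 1 * b $ 4 = a $ 4 * b $ 1" "a $ 2 * b $ 3 = a $ 3 * b $ 2"
    "a $ 1 * b $ 3 - a $ 3 * b $ 1 + (a $ 2 * b $ 4 - a $ 4 * b $ 2) = 0"
    using J by (simp_all add: J_eq a_def b_def)
  define j12 j13 j34 where "j12 = a $ 1 * b $ 2 - a $ 2 * b $ 1" and "j13 = a $ 1 * b $ 3 - a $ 3 * b $ 1"
    and "j34 = a $ 3 * b $ 4 - a $ 4 * b $ 3"
  \<comment> \<open>The Pluecker relation J12 J34 - J13 J24 + J14 J23 = 0 under the hypotheses on
    the minors.\<close>
  have plucker: "j13\<^sup>2 + j12 * j34 = 0"
    using j unfolding j12_def j13_def j34_def by algebra
  show thesis
  proof (cases "j12 = 0")
    case False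
    show thesis
    proof (rule that[of j12 j13])
      show "(j12, j13) \<noteq> (0, 0)" using False by simp
      fix y
      let ?U = "U A 1 y" and ?W = "U A 2 y"
      let ?u1 = "y 0 $ 1" and ?u2 = "y 0 $ 2" and ?v1 = "y pi $ 1" and ?v2 = "y pi $ 2"
      \<comment> \<open>Elimination by Cramer's rule; the identities \<open>3\<close> undo it, so no
        boundary information is lost.\<close>
      have 1: "b $ 2 * ?U - a $ 2 * ?W = j12 * ?u1 + j13 * ?v2"
        using j unfolding U j12_def j13_def by algebra
      have 2: "a $ 1 * ?W - b $ 1 * ?U = j12 * ?u2 + j13 * ?v1"
        using j unfolding U j12_def j13_def by algebra
      have 3: "j12 * ?U = a $ 1 * (b $ 2 * ?U - a $ 2 * ?W) + a $ 2 * (a $ 1 * ?W - b $ 1 * ?U)"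
        "j12 * ?W = b $ 1 * (b $ 2 * ?U - a $ 2 * ?W) + b $ 2 * (a $ 1 * ?W - b $ 1 * ?U)"
        unfolding j12_def by (simp_all add: algebra_simps)
      show "?U = 0 \<and> ?W = 0 \<longleftrightarrow> j12 *s y 0 + j13 *s swap (y pi) = 0"
        unfolding bc using 1 2 3 False by auto
    qed
  next
    case True
    then have "j13 = 0" using plucker by simp
    have "j34 \<noteq> 0"
    proof
      assume "j34 = 0"
      have minors: "a $ j * b $ k = a $ k * b $ j" for j k
        using exhaust_4[of j] exhaust_4[of k] j \<open>j34 = 0\<close> \<open>j13 = 0\<close> True
        unfolding j12_def j13_def j34_def by auto
      have "a $ j = 0" for j
      proof -
        \<comment> \<open>When all minors vanish, the entries of any column give a linear relation
          between the rows; so the first row is zero, which is itself a dependence.\<close>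
        have "b $ j *s row 1 A + (- a $ j) *s row 2 A = 0"
          using minors[of j] by (simp add: vec_eq_iff row_def a_def b_def mult.commute)
        from ind[OF this] show ?thesis by simp
      qed
      then have "1 *s row 1 A + 0 *s row 2 A = 0" by (simp add: vec_eq_iff row_def a_def)
      from ind[OF this] show False by simp
    qed
    show thesis
    proof (rule that[of 0 1])
      fix y
      let ?U = "U A 1 y" and ?W = "U A 2 y"
      let ?u1 = "y 0 $ 1" and ?u2 = "y 0 $ 2" and ?v1 = "y pi $ 1" and ?v2 = "y pi $ 2"
      have 1: "b $ 4 * ?U - a $ 4 * ?W = j34 * ?v1"
        using j \<open>j13 = 0\<close> unfolding U j34_def j13_def by algebra
      have 2: "a $ 3 * ?W - b $ 3 * ?U = j34 * ?v2"
        using j \<open>j13 = 0\<close> unfolding U j34_def j13_def by algebra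
      have 3: "j34 * ?U = a $ 3 * (b $ 4 * ?U - a $ 4 * ?W) + a $ 4 * (a $ 3 * ?W - b $ 3 * ?U)"
        "j34 * ?W = b $ 3 * (b $ 4 * ?U - a $ 4 * ?W) + b $ 4 * (a $ 3 * ?W - b $ 3 * ?U)"
        unfolding j34_def by (simp_all add: algebra_simps)
      show "?U = 0 \<and> ?W = 0 \<longleftrightarrow> 0 *s y 0 + 1 *s swap (y pi) = 0"
        unfolding bc using 1 2 3 \<open>j34 \<noteq> 0\<close> by auto
    qed simp
  qed
qed

section \<open>The alternative for the spectrum\<close>

lemma problem_spectrum_cases:
  assumes pq: "p \<in> L1" "q \<in> L1"
    and sym: "AE x in Leb. p (pi - x) = - p x" "AE x in Leb. q (pi - x) = q x"
    and nz: "(al, be) \<noteq> (0, 0)"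
    and bc: "\<And>y. U A 1 y = 0 \<and> U A 2 y = 0 \<longleftrightarrow> al *s y 0 + be *s swap (y pi) = 0"
  shows "problem_spectrum A p q = (if al\<^sup>2 = be\<^sup>2 then UNIV else {})"
proof -
  have Dom: "y \<in> Dom A p q \<longleftrightarrow> y \<in> W11 \<and> Lop p q y \<in> H \<and> al *s y 0 + be *s swap (y pi) = 0" for y
    unfolding Dom_def using bc[of y] by blast
  have zero: "(\<lambda>_. 0 :: complex^2) absolutely_integrable_on {0..pi}" by simp
  have zero_H: "(\<lambda>_. 0 :: complex^2) \<in> H" by (rule H_continuous_on) simp
  have swap0: "swap 0 = 0" by (rule vec2_eqI) auto
  have refl_sol: "solution p q lam (\<lambda>_. 0) (\<lambda>x. swap (y (pi - x)))" if "solution p q lam (\<lambda>_. 0) y" for lam y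
    using solution_reflect[OF pq zero sym that] by (simp add: swap0)
  have comb_sol: "solution p q lam (\<lambda>_. 0) (\<lambda>x. a *s y x + b *s z x)"
    if "solution p q lam (\<lambda>_. 0) y" "solution p q lam (\<lambda>_. 0) z" for lam y z a b
    using solution_linear[OF pq zero zero that, of a b] by simp
  show ?thesis
  proof (cases "al\<^sup>2 = be\<^sup>2")
    case True
    have "lam \<notin> resolvent_set (Dom A p q) (Lop p q)" for lam
    proof
      assume lam: "lam \<in> resolvent_set (Dom A p q) (Lop p q)"
      have mid: "pi / 2 \<in> {0..pi}" by simp
      obtain y where y: "solution p q lam (\<lambda>_. 0) y" "y (pi/2) = vector [1, 0]"
        using solution_exists[OF pq zero mid] by blast
      \<comment> \<open>At the fixed point \<pi>/2 of the reflection the value is al (1, 0) - be (0,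
        1), nonzero because al and be are not both zero.\<close>
      define u where "u x = al *s y x + (- be) *s swap (y (pi - x))" for x
      have u: "solution p q lam (\<lambda>_. 0) u" unfolding u_def by (rule comb_sol[OF y(1) refl_sol[OF y(1)]])
      note uW = solution_imp_W11[OF pq zero_H u]
      have "al *s u 0 + be *s swap (u pi) = (al\<^sup>2 - be\<^sup>2) *s y 0"
        by (rule vec2_eqI) (simp_all add: u_def power2_eq_square algebra_simps)
      then have uD: "u \<in> Dom A p q" using uW True by (simp add: Dom)
      \<comment> \<open>\<open>resolvent_set\<close> states injectivity for pairs of domain
        elements, so the zero function has to be placed in the domain as the partner of
        \<open>u\<close>.\<close>
      have "(\<lambda>_. 0) = (\<lambda>x. 0 *s u x + 0 *s u x)" by simp
      then have z: "solution p q lam (\<lambda>_. 0) (\<lambda>_. 0)" using comb_sol[OF u u, of 0 0] by simp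
      note zW = solution_imp_W11[OF pq zero_H z]
      have zD: "(\<lambda>_. 0) \<in> Dom A p q" using zW by (simp add: Dom swap0)
      have "AE x in Leb. Lop p q u x - lam *s u x = Lop p q (\<lambda>_. 0) x - lam *s 0"
        using uW(2) zW(2) by eventually_elim simp
      then have "AE x in Leb. u x = 0"
        using lam uD zD unfolding resolvent_set_def by blast
      then have "u (pi/2) = 0"
        using u by (intro continuous_on_AE_eq_0[of 0 pi]) (auto simp: solution_def)
      moreover have "u (pi/2) $ 1 = al" "u (pi/2) $ 2 = - be" by (simp_all add: u_def y(2))
      ultimately show False using nz by simp
    qed
    then show ?thesis using True by (auto simp: problem_spectrum_def spectrum_def)
  next
    case False
    define D where "D = al\<^sup>2 - be\<^sup>2"
    have D: "D \<noteq> 0" using False by (simp add: D_def)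
    have "lam \<in> resolvent_set (Dom A p q) (Lop p q)" for lam
    proof -
      have surj: "\<exists>y\<in>Dom A p q. AE x in Leb. Lop p q y x - lam *s y x = f x" if f: "f \<in> H" for f
      proof -
        have fi: "f absolutely_integrable_on {0..pi}" by (rule H_absolutely_integrable(1)[OF f])
        have 0: "0 \<in> {0..pi}" by simp
        obtain y where y: "solution p q lam f y" using solution_exists[OF pq fi 0] by blast
        \<comment> \<open>The boundary defect of an arbitrary solution. The homogeneous correction
          \<open>h\<close> has defect \<open>D *s k 0\<close>, so \<open>k 0\<close> is chosen to
          make this \<open>- w\<close>.\<close>
        define w where "w = al *s y 0 + be *s swap (y pi)"
        obtain k where k: "solution p q lam (\<lambda>_. 0) k" "k 0 = (- inverse D) *s w"
          using solution_exists[OF pq zero 0] by blast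
        define h where "h x = al *s k x + (- be) *s swap (k (pi - x))" for x
        have h: "solution p q lam (\<lambda>_. 0) h" unfolding h_def by (rule comb_sol[OF k(1) refl_sol[OF k(1)]])
        have "al *s h 0 + be *s swap (h pi) = D *s k 0"
          by (rule vec2_eqI) (simp_all add: h_def D_def power2_eq_square algebra_simps)
        also have "\<dots> = - w" using D unfolding k(2) by (intro vec2_eqI) simp_all
        finally have hb: "al *s h 0 + be *s swap (h pi) = - w" .
        define z where "z x = 1 *s y x + 1 *s h x" for x
        have "solution p q lam (\<lambda>x. 1 *s f x + 1 *s 0) z"
          unfolding z_def by (rule solution_linear[OF pq fi zero y h])
        then have z: "solution p q lam f z" by simp
        have "al *s z 0 + be *s swap (z pi) = w + (al *s h 0 + be *s swap (h pi))"
          by (rule vec2_eqI) (simp_all add: z_def w_def algebra_simps)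
        then have "al *s z 0 + be *s swap (z pi) = 0" unfolding hb by simp
        then have "z \<in> Dom A p q" using solution_imp_W11[OF pq f z] by (simp add: Dom)
        then show ?thesis using solution_imp_W11(2)[OF pq f z] by blast
      qed
      obtain K where K: "0 \<le> K" "\<And>f y x. \<lbrakk>f absolutely_integrable_on {0..pi}; solution p q lam f y; y 0 = 0; x \<in> {0..pi}\<rbrakk>
          \<Longrightarrow> norm (y x) \<le> K * integral {0..pi} (\<lambda>x. norm (f x))"
        using solution_bound[OF pq] by blast
      define a where "a = norm al + norm be"
      have a: "0 \<le> a" by (simp add: a_def)
      \<comment> \<open>One factor \<open>a\<close> bounds the right-hand side of the combined
        equation, \<open>K\<close> its solution, the other \<open>a\<close> the combination that
        returns \<open>D *s y x\<close>.\<close>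
      define C1 where "C1 = a * (K * a) / norm D"
      have C1: "0 \<le> C1" using K(1) a by (simp add: C1_def)
      have bound: "norm (y x) \<le> C1 * integral {0..pi} (\<lambda>x. norm (f x))"
        if f: "f absolutely_integrable_on {0..pi}" and y: "solution p q lam f y"
          and y0: "al *s y 0 + be *s swap (y pi) = 0" and x: "x \<in> {0..pi}" for f y x
      proof -
        let ?I = "integral {0..pi} (\<lambda>x. norm (f x))"
        let ?f = "\<lambda>x. swap (f (pi - x))"
        \<comment> \<open>The boundary condition is exactly \<open>u 0 = 0\<close>, the initial
          value under which \<open>K\<close> applies.\<close>
        define u where "u x = al *s y x + be *s swap (y (pi - x))" for x
        let ?g = "\<lambda>x. al *s f x + be *s ?f x"
        note f' = absolutely_integrable_swap_reflect[OF f]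
        have u: "solution p q lam ?g u"
          unfolding u_def by (rule solution_linear[OF pq f f'(1) y solution_reflect[OF pq f sym y]])
        have gi: "?g absolutely_integrable_on {0..pi}"
          using absolutely_integrable_linear[OF f bounded_linear_smult[of al]]
            absolutely_integrable_linear[OF f'(1) bounded_linear_smult[of be]]
          by (intro set_integral_add(1)) (simp_all add: o_def)
        have n: "(\<lambda>x. norm (f x)) integrable_on {0..pi}" "(\<lambda>x. norm (?f x)) integrable_on {0..pi}"
          "(\<lambda>x. norm (?g x)) integrable_on {0..pi}"
          using f f'(1) gi unfolding absolutely_integrable_on_def by blast+
        have "integral {0..pi} (\<lambda>x. norm (?g x)) \<le> integral {0..pi} (\<lambda>x. norm al * norm (f x) + norm be * norm (?f x))"
        proof (rule integral_le[OF n(3)])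
          show "(\<lambda>x. norm al * norm (f x) + norm be * norm (?f x)) integrable_on {0..pi}"
            by (intro Henstock_Kurzweil_Integration.integrable_add integrable_on_mult_right n)
          show "norm (?g x) \<le> norm al * norm (f x) + norm be * norm (?f x)" for x
            using norm_triangle_ineq[of "al *s f x" "be *s ?f x"] by (simp only: norm_smult)
        qed
        also have "\<dots> = norm al * ?I + norm be * integral {0..pi} (\<lambda>x. norm (?f x))"
          using n by (subst Henstock_Kurzweil_Integration.integral_add) (auto intro: integrable_on_mult_right)
        also have "\<dots> = a * ?I" unfolding f'(2) by (simp add: a_def distrib_right)
        finally have gI: "integral {0..pi} (\<lambda>x. norm (?g x)) \<le> a * ?I" .
        have ub: "norm (u t) \<le> K * (a * ?I)" if "t \<in> {0..pi}" for t
        proof -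
          have "norm (u t) \<le> K * integral {0..pi} (\<lambda>x. norm (?g x))"
            by (rule K(2)[OF gi u _ that]) (use y0 in \<open>simp add: u_def\<close>)
          also have "\<dots> \<le> K * (a * ?I)" by (rule mult_left_mono[OF gI K(1)])
          finally show ?thesis .
        qed
        have "D *s y x = al *s u x + (- be) *s swap (u (pi - x))"
          by (rule vec2_eqI) (simp_all add: u_def D_def power2_eq_square algebra_simps)
        then have "norm D * norm (y x) = norm (al *s u x + (- be) *s swap (u (pi - x)))"
          by (metis norm_smult)
        also have "\<dots> \<le> norm (al *s u x) + norm ((- be) *s swap (u (pi - x)))" by (rule norm_triangle_ineq)
        also have "\<dots> = norm al * norm (u x) + norm be * norm (u (pi - x))"
          unfolding norm_smult norm_swap norm_minus_cancel ..
        also have "\<dots> \<le> norm al * (K * (a * ?I)) + norm be * (K * (a * ?I))"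
          using ub[of x] ub[of "pi - x"] x by (intro add_mono mult_left_mono) auto
        also have "\<dots> = a * (K * a) * ?I" by (simp add: a_def algebra_simps)
        finally show ?thesis using D by (simp add: C1_def field_simps)
      qed
      \<comment> \<open>The last factor passes from the norm of \<open>H\<close> to the integral of
        the norm, the first from the supremum back to the norm of \<open>H\<close>.\<close>
      let ?C = "sqrt (2 * pi) * (C1 * (2 * sqrt pi))"
      have est: "norm_H y \<le> ?C * norm_H (\<lambda>x. Lop p q y x - lam *s y x)" if y: "y \<in> Dom A p q" for y
      proof -
        let ?f = "\<lambda>x. Lop p q y x - lam *s y x"
        have y': "y \<in> W11" "Lop p q y \<in> H" "al *s y 0 + be *s swap (y pi) = 0" using y by (auto simp: Dom)
        note f = W11_imp_solution[OF y'(1,2), of lam]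
        note fi = H_absolutely_integrable[OF f(1)]
        have "norm (y x) \<le> C1 * (2 * sqrt pi * norm_H ?f)" if "x \<in> {0..pi}" for x
          using bound[OF fi(1) f(2) y'(3) that] mult_left_mono[OF fi(2) C1] by linarith
        then have "norm_H y \<le> sqrt (2 * pi) * (C1 * (2 * sqrt pi * norm_H ?f))"
          using C1 norm_H_nonneg[of ?f] by (intro norm_H_le W11_continuous_on[OF y'(1)]) auto
        then show ?thesis by (simp add: mult_ac)
      qed
      have inj: "AE x in Leb. y x = z x" if y: "y \<in> Dom A p q" and z: "z \<in> Dom A p q"
        and eq: "AE x in Leb. Lop p q y x - lam *s y x = Lop p q z x - lam *s z x" for y z
      proof -
        let ?f = "\<lambda>x. Lop p q y x - lam *s y x" and ?g = "\<lambda>x. Lop p q z x - lam *s z x"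
        have y': "y \<in> W11" "Lop p q y \<in> H" "al *s y 0 + be *s swap (y pi) = 0" using y by (auto simp: Dom)
        have z': "z \<in> W11" "Lop p q z \<in> H" "al *s z 0 + be *s swap (z pi) = 0" using z by (auto simp: Dom)
        note f = W11_imp_solution[OF y'(1,2), of lam] and g = W11_imp_solution[OF z'(1,2), of lam]
        note fi = H_absolutely_integrable(1)[OF f(1)] and gi = H_absolutely_integrable(1)[OF g(1)]
        define u where "u x = 1 *s y x + (- 1) *s z x" for x
        let ?h = "\<lambda>x. 1 *s ?f x + (- 1) *s ?g x"
        have u: "solution p q lam ?h u" unfolding u_def by (rule solution_linear[OF pq fi gi f(2) g(2)])
        have hi: "?h absolutely_integrable_on {0..pi}"
          using absolutely_integrable_linear[OF fi bounded_linear_smult[of 1]]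
            absolutely_integrable_linear[OF gi bounded_linear_smult[of "-1"]]
          by (intro set_integral_add(1)) (simp_all only: o_def)
        have ub: "al *s u 0 + be *s swap (u pi) = 0"
        proof -
          have "al *s u 0 + be *s swap (u pi) = (al *s y 0 + be *s swap (y pi)) - (al *s z 0 + be *s swap (z pi))"
            by (rule vec2_eqI) (simp_all add: u_def algebra_simps)
          then show ?thesis using y'(3) z'(3) by simp
        qed
        \<comment> \<open>The right-hand side for the difference vanishes only almost everywhere,
          but \<open>bound\<close> sees it through its integral; hence \<open>y\<close> and
          \<open>z\<close> agree at every point of the interval.\<close>
        have "AE x in Leb. norm (?h x) = 0" using eq by eventually_elim simp
        then obtain Z where Z: "negligible Z" "\<And>x. x \<in> {0..pi} - Z \<Longrightarrow> norm (?h x) = 0"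
          by (rule AE_lebesgue_onE) auto
        have "integral {0..pi} (\<lambda>x. norm (?h x)) = integral {0..pi} (\<lambda>_. 0)"
          by (rule integral_spike[OF Z(1)]) (use Z(2) in auto)
        then have "u x = 0" if "x \<in> {0..pi}" for x
          using bound[OF hi u ub that] by simp
        then have "y x = z x" if "x \<in> {0..pi}" for x
          using that by (simp add: u_def)
        then show ?thesis by (intro AE_I2) simp
      qed
      show ?thesis
        unfolding resolvent_set_def using surj inj est by blast
    qed
    then show ?thesis using False by (auto simp: problem_spectrum_def spectrum_def)
  qed
qed

theorem theorem1:
  fixes A :: "complex^4^2" and p q :: "real \<Rightarrow> complex"
  assumes "p \<in> L1" and "q \<in> L1"
    and "\<And>c\<^sub>1 c\<^sub>2. c\<^sub>1 *s row 1 A + c\<^sub>2 *s row 2 A = 0 \<Longrightarrow> c\<^sub>1 = 0 \<and> c\<^sub>2 = 0"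
    and "J A 1 4 = 0" and "J A 2 3 = 0" and "J A 1 3 + J A 2 4 = 0"
    and "AE x in Leb. p (pi - x) = - p x"
    and "AE x in Leb. q (pi - x) = q x"
  shows "problem_spectrum A p q = problem_spectrum A (\<lambda>_. 0) (\<lambda>_. 0)"
proof -
  obtain al be where nz: "(al, be) \<noteq> (0, 0)"
    and bc: "\<And>y. U A 1 y = 0 \<and> U A 2 y = 0 \<longleftrightarrow> al *s y 0 + be *s swap (y pi) = 0"
    using boundary_condition[OF assms(3-6)] by blast
  have "(\<lambda>_. 0) \<in> L1" by (simp add: L1_def)
  from problem_spectrum_cases[OF this this _ _ nz bc] problem_spectrum_cases[OF assms(1,2,7,8) nz bc]
  show ?thesis by simp
qed

end
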